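(* Let $\Sigma_{[\mathbb{D}_4]}\subset\mathbb{E}\mathrm{la}$ be the tetragonal stratum. For a tetragonal elasticity tensor $\mathbf{E}=(\operatorname{tr}\mathbf{d},\operatorname{tr}\mathbf{v},\mathbf{d}',\mathbf{v}',\mathbf{H})\in\Sigma_{[\mathbb{D}_4]}$ set $$\mathbf{t}:=2\,\frac{\left(\|\mathbf{d}'\|^2\,\mathbf{d}'^2+\|\mathbf{v}'\|^2\,\mathbf{v}'^2+\mathbf{d}_2'^2\right)'}{\|\mathbf{d}'\|^4+\|\mathbf{v}'\|^4+\|\mathbf{d}_2'\|^2}.$$ A minimal functional basis for $\Sigma_{[\mathbb{D}_4]}$ (under the action of $\mathrm{SO}(3)$) consists of the six rational invariants $$\kappa_1:=\operatorname{tr}\mathbf{d},\quad \kappa_2:=\operatorname{tr}\mathbf{v},\quad \kappa_3:=\mathbf{d}:\mathbf{t},\quad \kappa_4:=\mathbf{v}:\mathbf{t},\quad \kappa_5:=\mathbf{t}:\mathbf{H}:\mathbf{t},\quad \kappa_6:=I_2.$$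
   Context: Tensors are on Euclidean $\mathbb{R}^3$, with components in an orthonormal basis $(e_i)$ and summation over repeated indices; $\mathbf{q}=(\delta_{ij})$ is the Euclidean metric. $\mathrm{SO}(3)$ acts on $n$th-order tensors by $(g\star \mathbf{T})_{i_1\dots i_n}=g_{i_1j_1}\cdots g_{i_nj_n}T_{j_1\dots j_n}$. $\mathbb{E}\mathrm{la}=\{\mathbf{E}\in\otimes^4(\mathbb{R}^3):E_{ijkl}=E_{klij}=E_{jikl}\}$ is the 21-dimensional space of elasticity tensors. $\mathbf{T}^s$ denotes the total symmetrization and $\mathbf{S}_1\odot\mathbf{S}_2:=(\mathbf{S}_1\otimes\mathbf{S}_2)^s$. For symmetric second-order tensors: $\mathbf{a}'=\mathbf{a}-\frac13(\operatorname{tr}\mathbf{a})\mathbf{q}$ (deviatoric part), $\mathbf{a}'^2=(\mathbf{a}')^2$ is the matrix square, $\mathbf{a}:\mathbf{b}=a_{ij}b_{ij}$, $\|\mathbf{a}\|^2=\mathbf{a}:\mathbf{a}$, and $\mathbf{a}:\mathbf{H}:\mathbf{b}=a_{ij}H_{ijkl}b_{kl}$. Harmonic decomposition: for $\mathbf{E}\in\mathbb{E}\mathrm{la}$, $d_{ij}=E_{kkij}$, $v_{ij}=E_{kikj}$, $\mathbf{a}=\frac27(\mathbf{d}+2\mathbf{v})$ and $\mathbf{H}=\mathbf{E}^s-\mathbf{q}\odot\mathbf{a}'-\frac{7}{30}(\operatorname{tr}\mathbf{a})\,\mathbf{q}\odot\mathbf{q}$, which is a totally symmetric traceless fourth-order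 tensor. The tensor $\mathbf{E}$ is identified with the tuple $(\operatorname{tr}\mathbf{d},\operatorname{tr}\mathbf{v},\mathbf{d}',\mathbf{v}',\mathbf{H})$ (an $\mathrm{SO}(3)$-equivariant linear isomorphism). Also $(\mathbf{d}_2)_{ij}=H_{ipqr}H_{pqrj}$ and $I_2=\operatorname{tr}\mathbf{d}_2$. For every tetragonal $\mathbf{E}$ one has $\|\mathbf{d}'\|^4+\|\mathbf{v}'\|^4+\|\mathbf{d}_2'\|^2\neq0$, so that $\mathbf{t}$ is well defined. Stratum: for a subgroup $K$ of $\mathrm{SO}(3)$, $\Sigma_{[K]}$ is the set of tensors whose symmetry group $\{g\in\mathrm{SO}(3):g\star\mathbf{E}=\mathbf{E}\}$ is conjugate to $K$ in $\mathrm{SO}(3)$. $\mathbb{D}_4$ is the order-8 subgroup generated by the rotation by $\pi/2$ about $e_3$ and the rotation by $\pi$ about $e_1$. A tensor is tetragonal if it belongs to $\Sigma_{[\mathbb{D}_4]}$. Functional basis: a finite set $\{\varphi_1,\dots,\varphi_s\}$ of $\mathrm{SO}(3)$-invariant real functions on an $\mathrm{SO}(3)$-stable set $X$ is a functional basis for $X$ if for every $\mathrm{SO}(3)$-invariant function $f:X\to\mathbb{R}$ there is a function $F:\mathbb{R}^s\to\mathbb{R}$ (no regularity required) with $f(x)=F(\varphi_1(x),\dots,\varphi_s(x))$ for all $x\in X$. It is minimal if no proper subset of it is a functional basis for $X$. *)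

theory Defs
  imports "HOL-Analysis.Analysis" "HOL-Algebra.Generated_Groups"
begin

text \<open>
  Tensors are given by their components in a fixed orthonormal basis. On second-order tensors
  the library operations \<open>\<bullet>\<close> and \<open>norm\<close> are the contraction \<open>a : b = a\<^sub>i\<^sub>j b\<^sub>i\<^sub>j\<close> and the
  Frobenius norm, \<open>**\<close> is the matrix product, and the metric \<open>q\<close> is \<open>mat 1\<close>.
\<close>

type_synonym tensor2 = "real ^ 3 ^ 3"
type_synonym tensor4 = "real ^ 3 ^ 3 ^ 3 ^ 3"

definition Ela :: "tensor4 set" where
  "Ela = {E. \<forall>i j k l. E $ i $ j $ k $ l = E $ k $ l $ i $ j
                      \<and> E $ i $ j $ k $ l = E $ j $ i $ k $ l}"

definition tensor_prod :: "tensor2 \<Rightarrow> tensor2 \<Rightarrow> tensor4" where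
  "tensor_prod S T = (\<chi> i j k l. S $ i $ j * T $ k $ l)"

definition total_sym :: "tensor4 \<Rightarrow> tensor4" where
  "total_sym T = (\<chi> i j k l.
     (\<Sum>\<sigma> | \<sigma> permutes {..<4::nat}.
        let I = (\<lambda>m. [i, j, k, l] ! \<sigma> m) in T $ I 0 $ I 1 $ I 2 $ I 3) / fact 4)"

definition sym_prod :: "tensor2 \<Rightarrow> tensor2 \<Rightarrow> tensor4" (infixl \<open>\<odot>\<close> 70) where
  "S \<odot> T = total_sym (tensor_prod S T)"

definition dev :: "tensor2 \<Rightarrow> tensor2" where
  "dev a = a - (trace a / 3) *\<^sub>R mat 1"

definition contract4 :: "tensor2 \<Rightarrow> tensor4 \<Rightarrow> tensor2 \<Rightarrow> real" where
  "contract4 a H b =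
     (\<Sum>i\<in>UNIV. \<Sum>j\<in>UNIV. \<Sum>k\<in>UNIV. \<Sum>l\<in>UNIV. a $ i $ j * H $ i $ j $ k $ l * b $ k $ l)"


definition SO3 :: "tensor2 monoid" where
  "SO3 = \<lparr>carrier = {g. rotation_matrix g}, mult = (**), one = mat 1\<rparr>"

definition act :: "tensor2 \<Rightarrow> tensor4 \<Rightarrow> tensor4" (infixr \<open>\<star>\<close> 75) where
  "g \<star> T = (\<chi> i j k l. \<Sum>p\<in>UNIV. \<Sum>q\<in>UNIV. \<Sum>r\<in>UNIV. \<Sum>s\<in>UNIV.
     g $ i $ p * g $ j $ q * g $ k $ r * g $ l $ s * T $ p $ q $ r $ s)"

definition symmetry_group :: "tensor4 \<Rightarrow> tensor2 set" where
  "symmetry_group E = {g \<in> carrier SO3. g \<star> E = E}"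

definition stratum :: "tensor2 set \<Rightarrow> tensor4 set" where
  "stratum K = {E \<in> Ela. \<exists>g \<in> carrier SO3.
     symmetry_group E = (\<lambda>h. g ** h ** matrix_inv g) ` K}"

definition rot_e3_quarter :: tensor2 where
  "rot_e3_quarter = vector [vector [0, -1, 0], vector [1, 0, 0], vector [0, 0, 1]]"

definition rot_e1_half :: tensor2 where
  "rot_e1_half = vector [vector [1, 0, 0], vector [0, -1, 0], vector [0, 0, -1]]"

definition D4 :: "tensor2 set" where
  "D4 = generate SO3 {rot_e3_quarter, rot_e1_half}"


text \<open>
  Real functions on \<open>X\<close> are the extensional ones, so that two invariants are identified exactly
  when they agree on \<open>X\<close>. For a set \<open>\<Phi>\<close> of \<open>s\<close> functions, \<open>\<lambda>\<phi>\<in>\<Phi>. \<phi> x\<close> is the tuple of their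
  values at \<open>x\<close>, indexed by \<open>\<Phi>\<close> itself instead of by \<open>1, \<dots>, s\<close>.
\<close>

definition stable :: "tensor4 set \<Rightarrow> bool" where
  "stable X \<longleftrightarrow> (\<forall>g \<in> carrier SO3. \<forall>x \<in> X. g \<star> x \<in> X)"

definition invariants :: "tensor4 set \<Rightarrow> (tensor4 \<Rightarrow> real) set" where
  "invariants X = {f \<in> X \<rightarrow>\<^sub>E UNIV. \<forall>g \<in> carrier SO3. \<forall>x \<in> X. f (g \<star> x) = f x}"

definition functional_basis :: "tensor4 set \<Rightarrow> (tensor4 \<Rightarrow> real) set \<Rightarrow> bool" where
  "functional_basis X \<Phi> \<longleftrightarrow> stable X \<and> finite \<Phi> \<and> \<Phi> \<subseteq> invariants X \<and>
     (\<forall>f \<in> invariants X. \<exists>F :: ((tensor4 \<Rightarrow> real) \<Rightarrow> real) \<Rightarrow> real.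
        \<forall>x \<in> X. f x = F (\<lambda>\<phi>\<in>\<Phi>. \<phi> x))"

definition minimal_functional_basis :: "tensor4 set \<Rightarrow> (tensor4 \<Rightarrow> real) set \<Rightarrow> bool" where
  "minimal_functional_basis X \<Phi> \<longleftrightarrow>
     functional_basis X \<Phi> \<and> (\<forall>\<Psi>. \<Psi> \<subset> \<Phi> \<longrightarrow> \<not> functional_basis X \<Psi>)"


text \<open>
  \<open>dil E\<close> and \<open>voigt E\<close> are the dilatation tensor \<open>d\<close> and the Voigt tensor \<open>v\<close>; \<open>harm E\<close> is the
  fourth-order harmonic component \<open>H\<close> of \<open>E\<close>.
\<close>

definition dil :: "tensor4 \<Rightarrow> tensor2" where
  "dil E = (\<chi> i j. \<Sum>k\<in>UNIV. E $ k $ k $ i $ j)"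

definition voigt :: "tensor4 \<Rightarrow> tensor2" where
  "voigt E = (\<chi> i j. \<Sum>k\<in>UNIV. E $ k $ i $ k $ j)"

definition harm :: "tensor4 \<Rightarrow> tensor4" where
  "harm E = (let a = (2/7) *\<^sub>R (dil E + 2 *\<^sub>R voigt E) in
     total_sym E - mat 1 \<odot> dev a - (7/30 * trace a) *\<^sub>R (mat 1 \<odot> mat 1))"

definition d2 :: "tensor4 \<Rightarrow> tensor2" where
  "d2 H = (\<chi> i j. \<Sum>p\<in>UNIV. \<Sum>q\<in>UNIV. \<Sum>r\<in>UNIV. H $ i $ p $ q $ r * H $ p $ q $ r $ j)"

text \<open>
  The denominator is positive on the tetragonal stratum, so that the convention \<open>x / 0 = 0\<close> plays
  no role there.
\<close>

definition t_tensor :: "tensor4 \<Rightarrow> tensor2" where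
  "t_tensor E = (let d' = dev (dil E); v' = dev (voigt E); d2' = dev (d2 (harm E)) in
     (2 / (norm d' ^ 4 + norm v' ^ 4 + norm d2' ^ 2)) *\<^sub>R
       dev ((norm d')\<^sup>2 *\<^sub>R (d' ** d') + (norm v')\<^sup>2 *\<^sub>R (v' ** v') + d2' ** d2'))"

definition kappa1 :: "tensor4 \<Rightarrow> real" where "kappa1 E = trace (dil E)"
definition kappa2 :: "tensor4 \<Rightarrow> real" where "kappa2 E = trace (voigt E)"
definition kappa3 :: "tensor4 \<Rightarrow> real" where "kappa3 E = dil E \<bullet> t_tensor E"
definition kappa4 :: "tensor4 \<Rightarrow> real" where "kappa4 E = voigt E \<bullet> t_tensor E"
definition kappa5 :: "tensor4 \<Rightarrow> real" where
  "kappa5 E = contract4 (t_tensor E) (harm E) (t_tensor E)"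
definition kappa6 :: "tensor4 \<Rightarrow> real" where "kappa6 E = trace (d2 (harm E))"

end

theory Submission
  imports Defs
begin

text \<open>
  Why the six functions form a basis. A tetragonal tensor is a rotated copy of a tensor \<open>N\<close> whose
  symmetry group is exactly \<open>D4\<close>. The \<open>D4\<close>-fixed tensors of \<open>Ela\<close> form a six-dimensional linear
  space, written here as \<open>tetragonal P R C F L s\<close>. On it \<open>d\<close>, \<open>v\<close> and \<open>d\<^sub>2\<close> are multiples of
  \<open>diag(1, 1, 0)\<close> plus multiples of \<open>diag(0, 0, 1)\<close>, and the harmonic part \<open>H\<close> has two parameters:
  a transversely isotropic one, \<open>x\<close>, and the coefficient \<open>s\<close> of the part varying like
  \<open>cos 4\<theta>\<close> about \<open>e\<^sub>3\<close>.

  The deviators \<open>d'\<close>, \<open>v'\<close>, \<open>d\<^sub>2'\<close> are \<open>y diag(1, 1, -2)\<close> for \<open>y = \<alpha>, \<beta>, \<gamma>\<close>; since squaring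
  such a deviator gives \<open>y\<^sup>2 diag(1, 1, 4)\<close>, the weights in the definition of \<open>t\<close> make it the
  constant tensor \<open>diag(-1, -1, 2) / 3\<close> as soon as one of \<open>\<alpha>, \<beta>, \<gamma>\<close> is nonzero
  (\<open>t_tensor_tetragonal\<close>). They cannot all vanish: otherwise \<open>s = \<plusminus>5 x\<close>, and \<open>N\<close> is invariant under a
  further rotation that moves the axis \<open>e\<^sub>3\<close>, so it is cubic or isotropic
  (\<open>symmetry_group_D4_imp_not_cubic\<close>). With \<open>t\<close> constant, the first five invariants are five
  independent linear functions of \<open>P, R, C, F, L\<close>, and \<open>I\<^sub>2 = 280 x\<^sup>2 + 8 s\<^sup>2\<close> determines \<open>s\<close> up to
  sign. The rotation by \<open>\<pi>/4\<close> about \<open>e\<^sub>3\<close> changes that sign. Hence the invariants separate orbits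
  (\<open>stratum_D4_separated\<close>), which, as no regularity is required, is the basis property.

  Minimality and the count of six follow from one fact: the values of the first five invariants
  can be prescribed at will, apart from \<open>\<kappa>\<^sub>3 \<noteq> 0\<close>, and then \<open>s \<noteq> 0\<close> can be chosen freely
  (\<open>stratum_D4_realises\<close>). So each invariant can be varied while the other five are kept fixed. That
  such tensors have no symmetry beyond \<open>D4\<close> is seen in two stages: \<open>d' \<noteq> 0\<close> forces a symmetry to
  preserve the axis \<open>e\<^sub>3\<close>, and \<open>s \<noteq> 0\<close> then leaves only the eight elements of \<open>D4\<close>.
\<close>

section \<open>The rotation action on second- and fourth-order tensors\<close>

text \<open>
  The action on second-order tensors, \<open>(g M)\<^sub>i\<^sub>j = g\<^sub>i\<^sub>p g\<^sub>j\<^sub>q M\<^sub>p\<^sub>q\<close>; see \<open>act2_nth\<close>.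
\<close>

definition act2 :: "tensor2 \<Rightarrow> tensor2 \<Rightarrow> tensor2" where
  "act2 g M = g ** M ** transpose g"

text \<open>
  A fourth-order tensor as a linear operator on second-order tensors, contracting its first two
  indices: \<open>M\<^sub>i\<^sub>j T\<^sub>i\<^sub>j\<^sub>k\<^sub>l\<close>. The action on \<open>T\<close> becomes conjugation of this operator by \<open>act2 g\<close>
  (\<open>apply4_act\<close>), and the operator determines \<open>T\<close>, so that equations between rotated tensors can be
  checked without expanding fourfold sums.
\<close>

definition apply4 :: "tensor4 \<Rightarrow> tensor2 \<Rightarrow> tensor2" where
  "apply4 T M = (\<Sum>i\<in>UNIV. \<Sum>j\<in>UNIV. M $ i $ j *\<^sub>R T $ i $ j)"

text \<open>
  The adjacent transpositions of the four indices. All index permutations, in particular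
  \<open>total_sym\<close>, the major symmetry and contractions of other index pairs, are reduced to these three.
\<close>

definition swap12 :: "tensor4 \<Rightarrow> tensor4" where "swap12 T = (\<chi> i j k l. T $ j $ i $ k $ l)"
definition swap23 :: "tensor4 \<Rightarrow> tensor4" where "swap23 T = (\<chi> i j k l. T $ i $ k $ j $ l)"
definition swap34 :: "tensor4 \<Rightarrow> tensor4" where "swap34 T = (\<chi> i j k l. T $ i $ j $ l $ k)"

lemma act2_nth: "act2 g M $ i $ j = (\<Sum>p\<in>UNIV. \<Sum>q\<in>UNIV. g $ i $ p * g $ j $ q * M $ p $ q)"
  unfolding act2_def
  by (simp add: matrix_matrix_mult_def transpose_def sum_distrib_left sum_distrib_right mult_ac)
     (rule sum.swap)

lemma act2_linear:
  "act2 g (A + B) = act2 g A + act2 g B" "act2 g (A - B) = act2 g A - act2 g B"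
  "act2 g (c *\<^sub>R A) = c *\<^sub>R act2 g A"
  by (simp_all add: vec_eq_iff act2_nth algebra_simps sum.distrib sum_subtractf sum_distrib_left)

lemma act2_sum: "act2 g (\<Sum>x\<in>X. f x) = (\<Sum>x\<in>X. act2 g (f x))"
  by (induction X rule: infinite_finite_induct) (auto simp: act2_linear, simp_all add: act2_def)

lemma orthogonal_matrix_transpose_mult:
  assumes "orthogonal_matrix (g :: tensor2)"
  shows "transpose g ** g = mat 1" "g ** transpose g = mat 1"
  using assms by (auto simp: orthogonal_matrix_def)

lemma act2_act2: "act2 g (act2 h M) = act2 (g ** h) M"
  by (simp add: act2_def matrix_transpose_mul matrix_mul_assoc)

lemma act2_id [simp]: "act2 (mat 1) M = M"
  by (simp add: act2_def)

context
  fixes g :: tensor2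
  assumes g: "orthogonal_matrix g"
begin

lemma act2_mat1: "act2 g (mat 1) = mat 1"
  using g by (simp add: act2_def orthogonal_matrix_def)

lemma act2_mult: "act2 g (A ** B) = act2 g A ** act2 g B"
proof -
  have "act2 g A ** act2 g B = g ** A ** (transpose g ** g) ** B ** transpose g"
    by (simp add: act2_def matrix_mul_assoc)
  also have "\<dots> = act2 g (A ** B)"
    unfolding orthogonal_matrix_transpose_mult[OF g] by (simp add: act2_def matrix_mul_assoc)
  finally show ?thesis by simp
qed

lemma trace_act2: "trace (act2 g A) = trace A"
proof -
  have "trace (act2 g A) = trace (transpose g ** (g ** A))"
    unfolding act2_def by (rule trace_mul_sym)
  then show ?thesis using g by (simp add: matrix_mul_assoc orthogonal_matrix_def)
qed

end

lemma inner_eq_trace: "(A :: tensor2) \<bullet> B = trace (A ** transpose B)"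
  by (simp add: inner_vec_def trace_def matrix_matrix_mult_def transpose_def)

lemma inner_act2:
  assumes "orthogonal_matrix g"
  shows "act2 g A \<bullet> act2 g B = A \<bullet> B"
proof -
  have "transpose (act2 g B) = act2 g (transpose B)"
    by (simp add: act2_def matrix_transpose_mul matrix_mul_assoc)
  then show ?thesis
    using assms by (simp add: inner_eq_trace flip: act2_mult) (rule trace_act2)
qed

lemma norm_act2: "orthogonal_matrix g \<Longrightarrow> norm (act2 g A) = norm A"
  by (simp add: norm_eq_sqrt_inner inner_act2)

lemma act_nth2:
  "(g \<star> T) $ i $ j = (\<Sum>p\<in>UNIV. \<Sum>q\<in>UNIV. (g $ i $ p * g $ j $ q) *\<^sub>R act2 g (T $ p $ q))"
  by (simp add: vec_eq_iff act_def act2_nth sum_distrib_left mult_ac)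

lemma apply4_act: "apply4 (g \<star> T) M = act2 g (apply4 T (act2 (transpose g) M))"
proof -
  let ?f = "\<lambda>i j p q. (M $ i $ j * (g $ i $ p * g $ j $ q)) *\<^sub>R act2 g (T $ p $ q)"
  have "apply4 (g \<star> T) M = (\<Sum>i\<in>UNIV. \<Sum>j\<in>UNIV. \<Sum>p\<in>UNIV. \<Sum>q\<in>UNIV. ?f i j p q)"
    by (simp add: apply4_def act_nth2 scaleR_sum_right)
  also have "\<dots> = (\<Sum>i\<in>UNIV. \<Sum>p\<in>UNIV. \<Sum>q\<in>UNIV. \<Sum>j\<in>UNIV. ?f i j p q)"
    by (rule sum.cong[OF refl], subst sum.swap, rule sum.cong[OF refl], rule sum.swap)
  also have "\<dots> = (\<Sum>p\<in>UNIV. \<Sum>q\<in>UNIV. \<Sum>i\<in>UNIV. \<Sum>j\<in>UNIV. ?f i j p q)"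
    by (subst sum.swap, rule sum.cong[OF refl], rule sum.swap)
  also have "\<dots> = act2 g (apply4 T (act2 (transpose g) M))"
    by (simp add: apply4_def act2_sum act2_linear act2_nth transpose_def scaleR_sum_left mult_ac)
  finally show ?thesis .
qed

lemma apply4_axis: "apply4 T (axis i (axis j 1)) = T $ i $ j"
proof -
  have "(\<Sum>j'\<in>UNIV. axis i (axis j 1) $ i' $ j' *\<^sub>R T $ i' $ j') = (if i' = i then T $ i $ j else 0)"
    for i'
    by (auto simp: axis_def if_distrib[of "\<lambda>x. x *\<^sub>R _"] cong: if_cong)
  then show ?thesis by (simp add: apply4_def)
qed

lemma apply4_inject: "(\<And>M. apply4 S M = apply4 T M) \<Longrightarrow> S = T"
  by (metis apply4_axis vec_eq_iff)

lemma act_act: "g \<star> h \<star> T = (g ** h) \<star> T"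
  by (rule apply4_inject) (simp add: apply4_act act2_act2 matrix_transpose_mul)

lemma act_id [simp]: "mat 1 \<star> T = T"
  by (rule apply4_inject) (simp add: apply4_act transpose_mat)

lemma act_eqI:
  assumes g: "orthogonal_matrix g"
    and eq: "\<And>M. act2 g (apply4 S M) = apply4 T (act2 g M)"
  shows "g \<star> S = T"
proof (rule apply4_inject)
  fix M
  show "apply4 (g \<star> S) M = apply4 T M"
    using g by (simp add: apply4_act eq act2_act2 orthogonal_matrix_def)
qed

lemma act_linear:
  "g \<star> (S + T) = g \<star> S + g \<star> T" "g \<star> (S - T) = g \<star> S - g \<star> T"
  "g \<star> (c *\<^sub>R T) = c *\<^sub>R (g \<star> T)"
  by (simp_all add: vec_eq_iff act_def algebra_simps sum.distrib sum_subtractf sum_distrib_left)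

lemma act_swap12: "swap12 (g \<star> T) = g \<star> swap12 T"
  unfolding vec_eq_iff swap12_def act_def
  by (auto simp: mult_ac intro: sum.swap)

lemma act_swap23: "swap23 (g \<star> T) = g \<star> swap23 T"
  unfolding vec_eq_iff swap23_def act_def
  by (auto simp: mult_ac intro!: sum.cong sum.swap)

lemma act_swap34: "swap34 (g \<star> T) = g \<star> swap34 T"
  unfolding vec_eq_iff swap34_def act_def
  by (auto simp: mult_ac intro!: sum.cong[OF refl] sum.swap)

lemma dil_eq_apply4: "dil T = apply4 T (mat 1)"
proof -
  have "(\<Sum>j\<in>UNIV. (mat 1 :: tensor2) $ i $ j *\<^sub>R T $ i $ j) = T $ i $ i" for i
    by (simp add: mat_def if_distrib[of "\<lambda>x. x *\<^sub>R _"] cong: if_cong)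
  then show ?thesis by (simp add: apply4_def dil_def vec_eq_iff)
qed

lemma dil_act: "orthogonal_matrix g \<Longrightarrow> dil (g \<star> T) = act2 g (dil T)"
  by (simp add: dil_eq_apply4 apply4_act act2_mat1 orthogonal_matrix_transpose)

lemma voigt_eq_dil: "voigt T = dil (swap23 T)"
  by (simp add: voigt_def dil_def swap23_def)

lemma voigt_act: "orthogonal_matrix g \<Longrightarrow> voigt (g \<star> T) = act2 g (voigt T)"
  by (simp add: voigt_eq_dil act_swap23 dil_act)

lemma dev_act2: "orthogonal_matrix g \<Longrightarrow> dev (act2 g A) = act2 g (dev A)"
  by (simp add: dev_def trace_act2 act2_linear act2_mat1)

lemma contract4_eq: "contract4 a H b = apply4 H a \<bullet> b"
proof -
  have "apply4 H a \<bullet> b = (\<Sum>i\<in>UNIV. \<Sum>j\<in>UNIV. a $ i $ j * (H $ i $ j \<bullet> b))"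
    by (simp add: apply4_def inner_sum_left)
  also have "\<dots> = contract4 a H b"
    by (simp add: contract4_def inner_vec_def sum_distrib_left mult_ac)
  finally show ?thesis by simp
qed

lemma contract4_act:
  assumes "orthogonal_matrix g"
  shows "contract4 (act2 g a) (g \<star> H) (act2 g b) = contract4 a H b"
  using assms
  by (simp add: contract4_eq apply4_act act2_act2 inner_act2 orthogonal_matrix_def)

lemma tensor_prod_act:
  assumes g: "orthogonal_matrix g"
  shows "tensor_prod (act2 g S) (act2 g T) = g \<star> tensor_prod S T"
proof -
  have *: "apply4 (tensor_prod S T) M = (M \<bullet> S) *\<^sub>R T" for S T M
    by (simp add: vec_eq_iff apply4_def tensor_prod_def inner_vec_def sum_distrib_left
      sum_distrib_right mult_ac)
  show ?thesis
    by (rule act_eqI[symmetric]) (simp_all add: g * act2_linear inner_act2)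
qed

section \<open>Equivariance of the covariants and invariance of the six functions\<close>

lemma total_sym_nth:
  "total_sym T $ i $ j $ k $ l =
    (T $ i $ j $ k $ l + T $ i $ j $ l $ k + T $ i $ k $ j $ l + T $ i $ k $ l $ j
   + T $ i $ l $ j $ k + T $ i $ l $ k $ j + T $ j $ i $ k $ l + T $ j $ i $ l $ k
   + T $ j $ k $ i $ l + T $ j $ k $ l $ i + T $ j $ l $ i $ k + T $ j $ l $ k $ i
   + T $ k $ i $ j $ l + T $ k $ i $ l $ j + T $ k $ j $ i $ l + T $ k $ j $ l $ i
   + T $ k $ l $ i $ j + T $ k $ l $ j $ i + T $ l $ i $ j $ k + T $ l $ i $ k $ j
   + T $ l $ j $ i $ k + T $ l $ j $ k $ i + T $ l $ k $ i $ j + T $ l $ k $ j $ i) / 24"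
proof -
  have s: "{..<4::nat} = {0, 1, 2, 3}" by auto
  have f: "finite {1, 2, 3::nat}" "0 \<notin> {1, 2, 3::nat}" "finite {2, 3::nat}" "1 \<notin> {2, 3::nat}"
    "finite {3::nat}" "2 \<notin> {3::nat}" by auto
  show ?thesis
    unfolding total_sym_def s sum_over_permutations_insert[OF f(1,2)]
      sum_over_permutations_insert[OF f(3,4)] sum_over_permutations_insert[OF f(5,6)] permutes_sing
    by (simp add: fact_numeral transpose_def Let_def)
qed

lemma swap_linear:
  "swap12 (S + T) = swap12 S + swap12 T" "swap12 (S - T) = swap12 S - swap12 T"
  "swap12 (c *\<^sub>R T) = c *\<^sub>R swap12 T"
  "swap23 (S + T) = swap23 S + swap23 T" "swap23 (S - T) = swap23 S - swap23 T"
  "swap23 (c *\<^sub>R T) = c *\<^sub>R swap23 T"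
  "swap34 (S + T) = swap34 S + swap34 T" "swap34 (S - T) = swap34 S - swap34 T"
  "swap34 (c *\<^sub>R T) = c *\<^sub>R swap34 T"
  by (simp_all add: vec_eq_iff swap12_def swap23_def swap34_def)

text \<open>
  The sum over the symmetric group on four letters, factored along the coset representatives of the
  chain of symmetric groups on two, three and four letters.
\<close>

lemma total_sym_eq_swaps:
  defines "U1 \<equiv> \<lambda>X. X + swap12 X"
    and "U2 \<equiv> \<lambda>X. X + swap23 X + swap12 (swap23 X)"
    and "U3 \<equiv> \<lambda>X. X + swap34 X + swap23 (swap34 X) + swap12 (swap23 (swap34 X))"
  shows "total_sym T = (1 / 24) *\<^sub>R U3 (U2 (U1 T))"
  by (simp add: assms vec_eq_iff total_sym_nth swap12_def swap23_def swap34_def)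

lemma total_sym_act: "total_sym (g \<star> T) = g \<star> total_sym T"
  by (simp add: total_sym_eq_swaps act_swap12 act_swap23 act_swap34 flip: act_linear)

text \<open>
  Invariance under all index permutations, expressed by the generating adjacent transpositions.
\<close>

definition totally_symmetric :: "tensor4 \<Rightarrow> bool" where
  "totally_symmetric T \<longleftrightarrow> swap12 T = T \<and> swap23 T = T \<and> swap34 T = T"

lemma totally_symmetric_total_sym: "totally_symmetric (total_sym T)"
  unfolding totally_symmetric_def
  by (simp add: vec_eq_iff swap12_def swap23_def swap34_def total_sym_nth)

lemma totally_symmetric_harm: "totally_symmetric (harm E)"
  using totally_symmetric_total_sym
  by (simp add: totally_symmetric_def harm_def Let_def sym_prod_def swap_linear)

lemma totally_symmetric_nth:
  assumes "totally_symmetric T"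
  shows "T $ i $ j $ k $ l = T $ j $ i $ k $ l" "T $ i $ j $ k $ l = T $ i $ k $ j $ l"
    "T $ i $ j $ k $ l = T $ i $ j $ l $ k"
  using assms unfolding totally_symmetric_def vec_eq_iff
  by (simp_all add: swap12_def swap23_def swap34_def)

lemma sym_prod_act:
  "orthogonal_matrix g \<Longrightarrow> act2 g S \<odot> act2 g T = g \<star> (S \<odot> T)"
  by (simp add: sym_prod_def tensor_prod_act total_sym_act)

lemma harm_act:
  assumes g: "orthogonal_matrix g"
  shows "harm (g \<star> E) = g \<star> harm E"
proof -
  have *: "mat 1 \<odot> act2 g T = g \<star> (mat 1 \<odot> T)" for T
    using sym_prod_act[OF g, of "mat 1"] by (simp add: act2_mat1 g)
  have **: "g \<star> (mat 1 \<odot> mat 1) = mat 1 \<odot> mat 1"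
    using *[of "mat 1"] by (simp add: act2_mat1 g)
  show ?thesis
    by (simp add: harm_def Let_def dil_act voigt_act g total_sym_act dev_act2 trace_act2 * **
        act_linear flip: act2_linear)
qed

text \<open>
  The contraction \<open>H\<^sub>i\<^sub>j\<^sub>p\<^sub>q H\<^sub>k\<^sub>l\<^sub>p\<^sub>q\<close>. For totally symmetric \<open>H\<close> it is the square of the operator
  \<open>apply4 H\<close> (\<open>apply4_compose4\<close>) and hence equivariant; \<open>d2 H\<close> is a contraction of it.
\<close>

definition compose4 :: "tensor4 \<Rightarrow> tensor4" where
  "compose4 H = (\<chi> i j k l. H $ i $ j \<bullet> H $ k $ l)"

lemma apply4_nth: "apply4 T M $ k $ l = (\<Sum>i\<in>UNIV. \<Sum>j\<in>UNIV. M $ i $ j * T $ i $ j $ k $ l)"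
  by (simp add: apply4_def)

lemma apply4_compose4:
  assumes H: "totally_symmetric H"
  shows "apply4 (compose4 H) M = apply4 H (apply4 H M)"
proof -
  have major: "H $ p $ q $ k $ l = H $ k $ l $ p $ q" for p q k l
    using totally_symmetric_nth[OF H] by metis
  have "apply4 (compose4 H) M $ k $ l = apply4 H M \<bullet> H $ k $ l" for k l
    by (simp add: apply4_nth compose4_def) (simp add: apply4_def inner_sum_left)
  also have "apply4 H M \<bullet> H $ k $ l = apply4 H (apply4 H M) $ k $ l" for k l
    by (simp add: inner_vec_def apply4_nth[of _ "apply4 H M"] major[of _ _ k l])
  finally show ?thesis by (simp add: vec_eq_iff)
qed

lemma totally_symmetric_act: "totally_symmetric H \<Longrightarrow> totally_symmetric (g \<star> H)"
  by (simp add: totally_symmetric_def act_swap12 act_swap23 act_swap34)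

lemma compose4_act:
  assumes g: "orthogonal_matrix g" and H: "totally_symmetric H"
  shows "compose4 (g \<star> H) = g \<star> compose4 H"
  using g by (intro act_eqI[symmetric])
    (simp_all add: apply4_compose4 totally_symmetric_act H apply4_act act2_act2
      orthogonal_matrix_def)

lemma d2_eq_dil:
  assumes H: "totally_symmetric H"
  shows "d2 H = dil (swap23 (swap12 (compose4 H)))"
proof -
  have 1: "H $ p $ q $ r $ j = H $ p $ j $ q $ r" for p q r j
    using totally_symmetric_nth[OF H] by metis
  have "d2 H $ i $ j = (\<Sum>p\<in>UNIV. H $ i $ p \<bullet> H $ p $ j)" for i j
    by (simp add: d2_def inner_vec_def) (intro sum.cong refl arg_cong[where f = "\<lambda>x. _ * x"] 1)
  then show ?thesis
    by (simp add: vec_eq_iff dil_def swap23_def swap12_def compose4_def)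
qed

lemma d2_act:
  assumes "orthogonal_matrix g" and "totally_symmetric H"
  shows "d2 (g \<star> H) = act2 g (d2 H)"
  using assms
  by (simp add: d2_eq_dil totally_symmetric_act compose4_act act_swap12 act_swap23 dil_act)

lemma t_tensor_act:
  assumes g: "orthogonal_matrix g"
  shows "t_tensor (g \<star> E) = act2 g (t_tensor E)"
  using totally_symmetric_harm[of E]
  by (simp add: t_tensor_def Let_def g dil_act voigt_act harm_act d2_act dev_act2 norm_act2
      flip: act2_linear act2_mult)

lemma kappa_act:
  assumes "orthogonal_matrix g"
  shows "kappa1 (g \<star> E) = kappa1 E" "kappa2 (g \<star> E) = kappa2 E" "kappa3 (g \<star> E) = kappa3 E"
    "kappa4 (g \<star> E) = kappa4 E" "kappa5 (g \<star> E) = kappa5 E" "kappa6 (g \<star> E) = kappa6 E"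
  using assms totally_symmetric_harm[of E]
  by (simp_all add: kappa1_def kappa2_def kappa3_def kappa4_def kappa5_def kappa6_def dil_act
      voigt_act t_tensor_act harm_act d2_act trace_act2 inner_act2 contract4_act)

section \<open>Symmetry groups and strata\<close>

lemma SO3_simps [simp]:
  "carrier SO3 = {g. rotation_matrix g}" "x \<otimes>\<^bsub>SO3\<^esub> y = x ** y" "\<one>\<^bsub>SO3\<^esub> = mat 1"
  by (simp_all add: SO3_def)

lemma rotation_matrix_mult: "rotation_matrix g \<Longrightarrow> rotation_matrix h \<Longrightarrow> rotation_matrix (g ** h)"
  for g h :: tensor2
  by (simp add: rotation_matrix_def orthogonal_matrix_mul det_mul)

lemma rotation_matrix_transpose: "rotation_matrix g \<Longrightarrow> rotation_matrix (transpose g)"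
  for g :: tensor2
  by (simp add: rotation_matrix_def)

lemma rotation_matrix_imp_orthogonal: "rotation_matrix g \<Longrightarrow> orthogonal_matrix g"
  for g :: tensor2
  by (simp add: rotation_matrix_def)

lemma rotation_matrix_id: "rotation_matrix (mat 1 :: tensor2)"
  by (simp add: rotation_matrix_def orthogonal_matrix_id)

lemma rotation_transpose_mult:
  assumes "rotation_matrix (g :: tensor2)"
  shows "transpose g ** g = mat 1" "g ** transpose g = mat 1"
    "transpose g ** (g ** h) = h" "g ** (transpose g ** h) = h"
  using assms by (simp_all add: rotation_matrix_def orthogonal_matrix_def matrix_mul_assoc)

lemma rotation_matrix_inv: "rotation_matrix (g :: tensor2) \<Longrightarrow> matrix_inv g = transpose g"
  unfolding matrix_inv_def
  by (rule some_equality) (auto simp: rotation_transpose_mult, metis matrix_mul_assoc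
      matrix_mul_lid matrix_mul_rid rotation_transpose_mult(1))

lemma group_SO3: "group SO3"
  by (rule groupI)
    (auto simp: rotation_matrix_mult rotation_matrix_id matrix_mul_assoc
      intro: rotation_matrix_transpose rotation_transpose_mult(1))

lemma inv_SO3: "rotation_matrix g \<Longrightarrow> inv\<^bsub>SO3\<^esub> g = transpose g"
  by (rule group.inv_equality[OF group_SO3])
    (auto simp: rotation_transpose_mult rotation_matrix_transpose)

lemma subgroup_SO3I:
  assumes "S \<subseteq> {g. rotation_matrix g}" "mat 1 \<in> S" "\<And>g h. g \<in> S \<Longrightarrow> h \<in> S \<Longrightarrow> g ** h \<in> S"
    "\<And>g. g \<in> S \<Longrightarrow> transpose g \<in> S"
  shows "subgroup S SO3"
  using assms by (intro subgroup.intro) (auto simp: inv_SO3)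

lemma subgroup_symmetry_group: "subgroup (symmetry_group E) SO3"
proof (rule subgroup_SO3I)
  show "transpose g \<in> symmetry_group E" if "g \<in> symmetry_group E" for g
  proof -
    have "transpose g \<star> g \<star> E = (transpose g ** g) \<star> E"
      by (rule act_act)
    also have "\<dots> = E"
      using that by (simp add: rotation_transpose_mult symmetry_group_def)
    finally have "transpose g \<star> g \<star> E = E" .
    moreover have "g \<star> E = E"
      using that by (simp add: symmetry_group_def)
    ultimately have "transpose g \<star> E = E"
      by simp
    then show ?thesis using that by (simp add: symmetry_group_def rotation_matrix_transpose)
  qed
qed (auto simp: symmetry_group_def rotation_matrix_id rotation_matrix_mult simp flip: act_act)

lemma symmetry_group_act:
  assumes g: "rotation_matrix g"
  shows "symmetry_group (g \<star> E) = (\<lambda>h. g ** h ** transpose g) ` symmetry_group E"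
proof -
  have *: "(\<lambda>h. g ** h ** transpose g) ` symmetry_group E \<subseteq> symmetry_group (g \<star> E)"
    if "rotation_matrix g" for g E
  proof clarsimp
    fix h assume h: "h \<in> symmetry_group E"
    have "(g ** h ** transpose g) \<star> g \<star> E = (g ** h) \<star> E"
      using that by (simp add: act_act rotation_transpose_mult flip: matrix_mul_assoc)
    also have "\<dots> = g \<star> E" using h by (simp add: symmetry_group_def flip: act_act)
    finally show "g ** h ** transpose g \<in> symmetry_group (g \<star> E)"
      using that h by (simp add: symmetry_group_def rotation_matrix_mult rotation_matrix_transpose)
  qed
  show ?thesis
  proof
    show "symmetry_group (g \<star> E) \<subseteq> (\<lambda>h. g ** h ** transpose g) ` symmetry_group E"
    proof
      fix h assume h: "h \<in> symmetry_group (g \<star> E)"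
      have "transpose g ** h ** g \<in> symmetry_group E"
        using *[OF rotation_matrix_transpose[OF g], of "g \<star> E"] h g
        by (auto simp: act_act rotation_transpose_mult)
      moreover have "h = g ** (transpose g ** h ** g) ** transpose g"
        using g by (simp add: rotation_transpose_mult flip: matrix_mul_assoc)
      ultimately show "h \<in> (\<lambda>h. g ** h ** transpose g) ` symmetry_group E" by blast
    qed
  qed (rule *[OF g])
qed

lemma mem_Ela_iff: "E \<in> Ela \<longleftrightarrow> swap12 E = E \<and> swap23 (swap34 (swap12 (swap23 E))) = E"
  unfolding Ela_def vec_eq_iff by (auto simp: swap12_def swap23_def swap34_def)

lemma act_mem_Ela: "E \<in> Ela \<Longrightarrow> g \<star> E \<in> Ela"
  by (simp add: mem_Ela_iff act_swap12 act_swap23 act_swap34)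

text \<open>
  The stratum consists of the rotated copies of the tensors whose symmetry group is \<open>K\<close> itself, not
  only conjugate to \<open>K\<close>.
\<close>

lemma mem_stratum_iff:
  "E \<in> stratum K \<longleftrightarrow>
    (\<exists>g N. rotation_matrix g \<and> E = g \<star> N \<and> N \<in> Ela \<and> symmetry_group N = K)"
proof
  assume "E \<in> stratum K"
  then obtain g where E: "E \<in> Ela" and g: "rotation_matrix g"
    and sym: "symmetry_group E = (\<lambda>h. g ** h ** transpose g) ` K"
    by (auto simp: stratum_def rotation_matrix_inv)
  let ?N = "transpose g \<star> E"
  have "symmetry_group ?N = K"
    using g by (simp add: symmetry_group_act rotation_matrix_transpose sym image_image
      rotation_transpose_mult flip: matrix_mul_assoc)
  moreover have "E = g \<star> ?N" using g by (simp add: act_act rotation_transpose_mult)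
  ultimately show "\<exists>g N. rotation_matrix g \<and> E = g \<star> N \<and> N \<in> Ela \<and> symmetry_group N = K"
    using g E act_mem_Ela by blast
next
  assume "\<exists>g N. rotation_matrix g \<and> E = g \<star> N \<and> N \<in> Ela \<and> symmetry_group N = K"
  then show "E \<in> stratum K"
    by (auto simp: stratum_def symmetry_group_act act_mem_Ela rotation_matrix_inv)
qed

lemma stable_stratum: "stable (stratum K)"
  unfolding stable_def
proof safe
  fix h E assume "h \<in> carrier SO3" "E \<in> stratum K"
  then obtain g N where "rotation_matrix h" "rotation_matrix g" "E = g \<star> N" "N \<in> Ela"
    "symmetry_group N = K"
    by (auto simp: mem_stratum_iff)
  then have "rotation_matrix (h ** g)" "h \<star> E = (h ** g) \<star> N"
    by (simp_all add: rotation_matrix_mult act_act)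
  then show "h \<star> E \<in> stratum K"
    using \<open>N \<in> Ela\<close> \<open>symmetry_group N = K\<close> unfolding mem_stratum_iff by blast
qed

section \<open>Tensors with tetragonal symmetry about the third axis\<close>

text \<open>
  The diagonal tensor \<open>diag(a, a, c)\<close>. The third axis is the value \<open>3\<close> of the index type, which is
  also its \<open>0\<close>.
\<close>

definition uniaxial :: "real \<Rightarrow> real \<Rightarrow> tensor2" where
  "uniaxial a c = (\<chi> i j. if i = j then if i = 3 then c else a else 0)"

text \<open>
  The general \<open>D4\<close>-fixed tensor of \<open>Ela\<close>, with components \<open>E\<^sub>1\<^sub>1\<^sub>1\<^sub>1 = P + s\<close>, \<open>E\<^sub>1\<^sub>1\<^sub>2\<^sub>2 = R - s\<close>,
  \<open>E\<^sub>1\<^sub>2\<^sub>1\<^sub>2 = (P - R) / 2 - s\<close>, \<open>E\<^sub>3\<^sub>3\<^sub>3\<^sub>3 = C\<close>, \<open>E\<^sub>1\<^sub>1\<^sub>3\<^sub>3 = F\<close> and \<open>E\<^sub>1\<^sub>3\<^sub>1\<^sub>3 = L\<close>. The parameters are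
  chosen so that \<open>s = 0\<close> is transverse isotropy and \<open>s\<close> is the coefficient of the part varying like
  \<open>cos 4\<theta>\<close>, which the rotation by \<open>\<pi>/4\<close> about \<open>e\<^sub>3\<close> negates.
\<close>

definition tetragonal :: "real \<Rightarrow> real \<Rightarrow> real \<Rightarrow> real \<Rightarrow> real \<Rightarrow> real \<Rightarrow> tensor4" where
  "tetragonal P R C F L s = (\<chi> i j k l.
     if i = j \<and> k = l then
       if i = 3 \<and> k = 3 then C else if i = 3 \<or> k = 3 then F
       else if i = k then P + s else R - s
     else if i = k \<and> j = l \<or> i = l \<and> j = k then
       if i = 3 \<or> j = 3 then L else (P - R) / 2 - s
     else 0)"

lemma uniaxial_simps:
  "uniaxial a c + uniaxial a' c' = uniaxial (a + a') (c + c')"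
  "uniaxial a c - uniaxial a' c' = uniaxial (a - a') (c - c')"
  "x *\<^sub>R uniaxial a c = uniaxial (x * a) (x * c)"
  "uniaxial a c ** uniaxial a' c' = uniaxial (a * a') (c * c')"
  "trace (uniaxial a c) = 2 * a + c"
  "uniaxial a c \<bullet> uniaxial a' c' = 2 * a * a' + c * c'"
  "dev (uniaxial a c) = uniaxial ((a - c) / 3) (2 * (c - a) / 3)"
  by (simp_all add: vec_eq_iff forall_3 sum_3 uniaxial_def matrix_matrix_mult_def trace_def
    inner_vec_def dev_def mat_def field_simps)

lemma norm_uniaxial: "(norm (uniaxial a c))\<^sup>2 = 2 * a\<^sup>2 + c\<^sup>2"
  by (simp only: power2_norm_eq_inner uniaxial_simps) (simp add: power2_eq_square)

lemma norm_uniaxial_4: "norm (uniaxial a c) ^ 4 = (2 * a\<^sup>2 + c\<^sup>2)\<^sup>2"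
proof -
  have "norm (uniaxial a c) ^ 4 = ((norm (uniaxial a c))\<^sup>2)\<^sup>2" by (simp flip: power_mult)
  then show ?thesis by (simp only: norm_uniaxial)
qed

lemma dil_tetragonal: "dil (tetragonal P R C F L s) = uniaxial (P + R + F) (2 * F + C)"
  by (simp add: vec_eq_iff forall_3 sum_3 uniaxial_def tetragonal_def dil_def)

lemma voigt_tetragonal:
  "voigt (tetragonal P R C F L s) = uniaxial ((3 * P - R) / 2 + L) (2 * L + C)"
  by (simp add: vec_eq_iff forall_3 sum_3 uniaxial_def tetragonal_def voigt_def field_simps)

lemma d2_tetragonal_harmonic:
  "d2 (tetragonal (3 * x) x (8 * x) (-4 * x) (-4 * x) s) =
    uniaxial (60 * x\<^sup>2 + 4 * s\<^sup>2) (160 * x\<^sup>2)"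
  by (simp add: vec_eq_iff forall_3 sum_3 uniaxial_def tetragonal_def d2_def)
    (simp add: power2_eq_square algebra_simps)

lemma tetragonal_mem_Ela: "tetragonal P R C F L s \<in> Ela"
  unfolding Ela_def tetragonal_def by (auto split: if_splits)

lemma Ela_nth:
  assumes "E \<in> Ela"
  shows "E $ i $ j $ k $ l = E $ k $ l $ i $ j" "E $ i $ j $ k $ l = E $ j $ i $ k $ l"
    "E $ i $ j $ k $ l = E $ i $ j $ l $ k"
proof -
  have major: "E $ i $ j $ k $ l = E $ k $ l $ i $ j"
    and minor: "E $ i $ j $ k $ l = E $ j $ i $ k $ l" for i j k l
    using assms unfolding Ela_def by blast+
  show "E $ i $ j $ k $ l = E $ k $ l $ i $ j" "E $ i $ j $ k $ l = E $ j $ i $ k $ l"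
    by (fact major minor)+
  show "E $ i $ j $ k $ l = E $ i $ j $ l $ k" by (metis major minor)
qed

lemma total_sym_Ela:
  assumes "E \<in> Ela"
  shows "total_sym E $ i $ j $ k $ l = (E $ i $ j $ k $ l + E $ i $ k $ j $ l + E $ i $ l $ j $ k) / 3"
  unfolding total_sym_nth by (simp add: Ela_nth[OF assms])

lemma sym_prod_mat1_uniaxial_nth:
  fixes a c :: real
  defines "S \<equiv> mat 1 :: tensor2" and "T \<equiv> uniaxial a c"
  shows "(S \<odot> T) $ i $ j $ k $ l =
    (S $ i $ j * T $ k $ l + S $ k $ l * T $ i $ j + S $ i $ k * T $ j $ l
   + S $ j $ l * T $ i $ k + S $ i $ l * T $ j $ k + S $ j $ k * T $ i $ l) / 6"
proof -
  have 1: "S $ i $ j = S $ j $ i" "T $ i $ j = T $ j $ i" for i j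
    by (auto simp: S_def T_def mat_def uniaxial_def)
  show ?thesis
    unfolding sym_prod_def total_sym_nth by (simp add: tensor_prod_def 1)
qed

text \<open>
  The harmonic part is again of the same form, with \<open>s\<close> unchanged and the other five parameters
  proportional to \<open>(3, 1, 8, -4, -4)\<close>.
\<close>

lemma harm_tetragonal:
  defines "x \<equiv> \<lambda>P C F L. (P + C - 2 * F - 4 * L) / 35"
  shows "harm (tetragonal P R C F L s) =
    tetragonal (3 * x P C F L) (x P C F L) (8 * x P C F L) (-4 * x P C F L) (-4 * x P C F L) s"
proof -
  have m: "mat 1 = uniaxial 1 1" by (simp add: vec_eq_iff mat_def uniaxial_def)
  show ?thesis
    unfolding harm_def Let_def dil_tetragonal voigt_tetragonal uniaxial_simps
    by (simp add: vec_eq_iff total_sym_Ela[OF tetragonal_mem_Ela]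
        sym_prod_mat1_uniaxial_nth sym_prod_mat1_uniaxial_nth[of 1 1, folded m])
      (simp add: forall_3 mat_def uniaxial_def tetragonal_def x_def, simp add: field_simps)
qed

text \<open>
  The three alternatives in the hypothesis say that \<open>d'\<close>, \<open>v'\<close> or \<open>d\<^sub>2'\<close> is nonzero, which makes the
  denominator of \<open>t\<close> positive.
\<close>

lemma t_tensor_tetragonal:
  assumes "P + R + F \<noteq> 2 * F + C \<or> (3 * P - R) / 2 + L \<noteq> 2 * L + C \<or>
    s\<^sup>2 \<noteq> 25 * ((P + C - 2 * F - 4 * L) / 35)\<^sup>2"
  shows "t_tensor (tetragonal P R C F L s) = uniaxial (- 1 / 3) (2 / 3)"
proof -
  define x where "x = (P + C - 2 * F - 4 * L) / 35"
  define \<alpha> where "\<alpha> = (P + R + F - (2 * F + C)) / 3"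
  define \<beta> where "\<beta> = ((3 * P - R) / 2 + L - (2 * L + C)) / 3"
  define \<gamma> where "\<gamma> = (60 * x\<^sup>2 + 4 * s\<^sup>2 - 160 * x\<^sup>2) / 3"
  define n where "n = 6 * \<alpha> ^ 4 + 6 * \<beta> ^ 4 + \<gamma>\<^sup>2"
  have \<gamma>: "\<gamma> = 4 * (s\<^sup>2 - 25 * x\<^sup>2) / 3" by (simp add: \<gamma>_def)
  have "\<alpha> \<noteq> 0 \<or> \<beta> \<noteq> 0 \<or> \<gamma> \<noteq> 0"
    unfolding \<gamma> using assms by (auto simp: \<alpha>_def \<beta>_def x_def)
  then have "0 < \<alpha> ^ 4 \<or> 0 < \<beta> ^ 4 \<or> 0 < \<gamma>\<^sup>2" by auto
  moreover have "0 \<le> \<alpha> ^ 4" "0 \<le> \<beta> ^ 4" "0 \<le> \<gamma>\<^sup>2" by auto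
  ultimately have n: "n > 0" unfolding n_def by linarith
  have dev_uniaxial: "dev (uniaxial a c) = uniaxial ((a - c) / 3) (- 2 * ((a - c) / 3))" for a c
    by (simp add: uniaxial_simps diff_divide_distrib)
  have dev: "dev (dil (tetragonal P R C F L s)) = uniaxial \<alpha> (- 2 * \<alpha>)"
    "dev (voigt (tetragonal P R C F L s)) = uniaxial \<beta> (- 2 * \<beta>)"
    "dev (d2 (harm (tetragonal P R C F L s))) = uniaxial \<gamma> (- 2 * \<gamma>)"
    unfolding dil_tetragonal voigt_tetragonal harm_tetragonal d2_tetragonal_harmonic
      dev_uniaxial x_def[symmetric] \<alpha>_def \<beta>_def \<gamma>_def
    by simp_all
  have norms: "(norm (uniaxial y (- 2 * y)))\<^sup>2 = 6 * y\<^sup>2" "norm (uniaxial y (- 2 * y)) ^ 4 = 36 * y ^ 4"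
    for y by (simp_all only: norm_uniaxial norm_uniaxial_4) (simp_all add: power_mult_distrib flip: power_mult)
  have "t_tensor (tetragonal P R C F L s) = (2 / (6 * n)) *\<^sub>R dev (uniaxial n (4 * n))"
    unfolding t_tensor_def Let_def dev norms uniaxial_simps(3,4) uniaxial_simps(1)
    by (simp add: n_def algebra_simps power2_eq_square power4_eq_xxxx)
  also have "\<dots> = uniaxial (- 1 / 3) (2 / 3)"
    using n by (simp add: uniaxial_simps)
  finally show ?thesis .
qed

text \<open>
  Only \<open>\<kappa>\<^sub>3\<close>, \<open>\<kappa>\<^sub>4\<close> and \<open>\<kappa>\<^sub>5\<close> involve \<open>t\<close> and so need the hypothesis under which \<open>t\<close> is constant.
\<close>

lemma kappa_tetragonal:
  defines "N \<equiv> tetragonal" and "x \<equiv> \<lambda>P C F L. (P + C - 2 * F - 4 * L) / 35"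
  shows "kappa1 (N P R C F L s) = 2 * (P + R + F) + (2 * F + C)"
    "kappa2 (N P R C F L s) = 2 * ((3 * P - R) / 2 + L) + (2 * L + C)"
    "kappa6 (N P R C F L s) = 280 * (x P C F L)\<^sup>2 + 8 * s\<^sup>2"
    "P + R + F \<noteq> 2 * F + C \<or> (3 * P - R) / 2 + L \<noteq> 2 * L + C \<or> s\<^sup>2 \<noteq> 25 * (x P C F L)\<^sup>2 \<Longrightarrow>
      kappa3 (N P R C F L s) = 2 / 3 * ((2 * F + C) - (P + R + F)) \<and>
      kappa4 (N P R C F L s) = 2 / 3 * ((2 * L + C) - ((3 * P - R) / 2 + L)) \<and>
      kappa5 (N P R C F L s) = 8 * x P C F L"
proof -
  have 1: "contract4 (uniaxial a c) (tetragonal P' R' C' F' L' s') (uniaxial a c) =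
      2 * (P' + R') * a\<^sup>2 + 4 * F' * a * c + C' * c\<^sup>2" for a c P' R' C' F' L' s'
    unfolding contract4_def sum_3
    by (simp add: uniaxial_def tetragonal_def power2_eq_square algebra_simps)
  note defs = N_def x_def kappa1_def kappa2_def kappa3_def kappa4_def kappa5_def kappa6_def
    dil_tetragonal voigt_tetragonal harm_tetragonal d2_tetragonal_harmonic uniaxial_simps
  show "kappa1 (N P R C F L s) = 2 * (P + R + F) + (2 * F + C)"
    "kappa2 (N P R C F L s) = 2 * ((3 * P - R) / 2 + L) + (2 * L + C)"
    "kappa6 (N P R C F L s) = 280 * (x P C F L)\<^sup>2 + 8 * s\<^sup>2"
    unfolding defs by simp_all
  assume A: "P + R + F \<noteq> 2 * F + C \<or> (3 * P - R) / 2 + L \<noteq> 2 * L + C \<or> s\<^sup>2 \<noteq> 25 * (x P C F L)\<^sup>2"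
  show "kappa3 (N P R C F L s) = 2 / 3 * ((2 * F + C) - (P + R + F)) \<and>
      kappa4 (N P R C F L s) = 2 / 3 * ((2 * L + C) - ((3 * P - R) / 2 + L)) \<and>
      kappa5 (N P R C F L s) = 8 * x P C F L"
    unfolding defs t_tensor_tetragonal[OF A[unfolded x_def]] 1
    by (simp add: field_simps)
qed

text \<open>
  For a signed permutation matrix each component of the rotated tensor is a single signed component
  of the original one.
\<close>

lemma act_monomial:
  assumes "\<And>i p. g $ i $ p = (if p = \<pi> i then \<epsilon> i else 0)"
  shows "(g \<star> T) $ i $ j $ k $ l =
    \<epsilon> i * \<epsilon> j * \<epsilon> k * \<epsilon> l * T $ \<pi> i $ \<pi> j $ \<pi> k $ \<pi> l"
  unfolding act_def
  by (simp add: assms if_distrib[of "\<lambda>x. x * _"] if_distrib[of "\<lambda>x. _ * x"] cong: if_cong)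

lemma rot_e3_quarter_act:
  "(rot_e3_quarter \<star> T) $ i $ j $ k $ l =
     (let \<epsilon> = (\<lambda>i. if i = 1 then - 1 else 1); \<pi> = (\<lambda>i::3. if i = 1 then 2 else if i = 2 then 1 else 3)
      in \<epsilon> i * \<epsilon> j * \<epsilon> k * \<epsilon> l * T $ \<pi> i $ \<pi> j $ \<pi> k $ \<pi> l)"
proof -
  have "\<forall>i p. rot_e3_quarter $ i $ p =
    (if p = (if i = 1 then 2 else if i = 2 then 1 else 3) then if i = 1 then - 1 else 1 else 0)"
    unfolding forall_3 by (simp add: rot_e3_quarter_def)
  then show ?thesis unfolding Let_def by (intro act_monomial) blast
qed

lemma rot_e1_half_act:
  "(rot_e1_half \<star> T) $ i $ j $ k $ l =
     (let \<epsilon> = (\<lambda>i::3. if i = 1 then 1 else - 1) in \<epsilon> i * \<epsilon> j * \<epsilon> k * \<epsilon> l * T $ i $ j $ k $ l)"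
proof -
  have "\<forall>i p. rot_e1_half $ i $ p = (if p = i then if i = 1 then 1 else - 1 else 0)"
    unfolding forall_3 by (simp add: rot_e1_half_def)
  then show ?thesis unfolding Let_def by (intro act_monomial[where \<pi> = "\<lambda>i. i"]) blast
qed

text \<open>
  The rotation by \<open>\<pi>/2\<close> about \<open>e\<^sub>1\<close>, which takes \<open>e\<^sub>3\<close> to \<open>-e\<^sub>2\<close> and so is not in \<open>D4\<close>.
\<close>

definition rot_e1_quarter :: tensor2 where
  "rot_e1_quarter = vector [vector [1, 0, 0], vector [0, 0, -1], vector [0, 1, 0]]"

lemma rot_e1_quarter_act:
  "(rot_e1_quarter \<star> T) $ i $ j $ k $ l =
     (let \<epsilon> = (\<lambda>i. if i = 2 then - 1 else 1); \<pi> = (\<lambda>i::3. if i = 1 then 1 else if i = 2 then 3 else 2)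
      in \<epsilon> i * \<epsilon> j * \<epsilon> k * \<epsilon> l * T $ \<pi> i $ \<pi> j $ \<pi> k $ \<pi> l)"
proof -
  have "\<forall>i p. rot_e1_quarter $ i $ p =
    (if p = (if i = 1 then 1 else if i = 2 then 3 else 2) then if i = 2 then - 1 else 1 else 0)"
    unfolding forall_3 by (simp add: rot_e1_quarter_def)
  then show ?thesis unfolding Let_def by (intro act_monomial) blast
qed

lemma act_tetragonal:
  "rot_e3_quarter \<star> tetragonal P R C F L s = tetragonal P R C F L s"
  "rot_e1_half \<star> tetragonal P R C F L s = tetragonal P R C F L s"
  by (simp_all add: vec_eq_iff rot_e3_quarter_act rot_e1_half_act forall_3 tetragonal_def)

text \<open>
  Under the three equations the three axes play the same role in \<open>tetragonal P R C F L s\<close>, which is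
  then cubic, or isotropic when \<open>s = 0\<close>.
\<close>

lemma act_cubic:
  "C = P + s \<Longrightarrow> F = R - s \<Longrightarrow> L = (P - R) / 2 - s \<Longrightarrow>
    rot_e1_quarter \<star> tetragonal P R C F L s = tetragonal P R C F L s"
  by (simp add: vec_eq_iff rot_e1_quarter_act forall_3 tetragonal_def)

text \<open>
  The rotation by \<open>\<pi>/4\<close> about \<open>e\<^sub>3\<close>; it normalises \<open>D4\<close> without belonging to it.
\<close>

definition rot_e3_eighth :: tensor2 where
  "rot_e3_eighth = (let c = 1 / sqrt 2 in vector [vector [c, - c, 0], vector [c, c, 0], vector [0, 0, 1]])"

lemma rotations:
  "rotation_matrix rot_e3_quarter" "rotation_matrix rot_e1_half" "rotation_matrix rot_e1_quarter"
  "rotation_matrix rot_e3_eighth"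
  by (simp_all add: rotation_matrix_def orthogonal_matrix vec_eq_iff forall_3 sum_3 transpose_def
      matrix_matrix_mult_def mat_def det_3 rot_e3_quarter_def rot_e1_half_def rot_e1_quarter_def
      rot_e3_eighth_def Let_def)

lemma rot_e3_eighth_act:
  "rot_e3_eighth \<star> tetragonal P R C F L s = tetragonal P R C F L (- s)"
proof (rule act_eqI)
  define c :: real where "c = 1 / sqrt 2"
  have c: "c * c = 1 / 2" "c * (c * y) = y / 2" for y by (simp_all add: c_def)
  show "act2 rot_e3_eighth (apply4 (tetragonal P R C F L s) M) =
      apply4 (tetragonal P R C F L (- s)) (act2 rot_e3_eighth M)" for M
    by (simp add: vec_eq_iff forall_3 act2_nth apply4_nth sum_3 tetragonal_def rot_e3_eighth_def Let_def
        flip: c_def) (simp add: algebra_simps c, simp add: field_simps)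
qed (use rotations rotation_matrix_imp_orthogonal in blast)

text \<open>
  A component that is nonzero has an even number of indices \<open>1\<close> and of indices \<open>3\<close>, because of the
  half turns about \<open>e\<^sub>1\<close> and \<open>e\<^sub>3\<close>, and so also of indices \<open>2\<close>. The quarter turn exchanges \<open>1\<close> and
  \<open>2\<close>. The value of \<open>s\<close> is forced by \<open>E\<^sub>1\<^sub>1\<^sub>1\<^sub>1 - E\<^sub>1\<^sub>1\<^sub>2\<^sub>2 - 2 E\<^sub>1\<^sub>2\<^sub>1\<^sub>2 = 4 s\<close>.
\<close>

lemma tetragonalI:
  assumes Ela: "E \<in> Ela" and r: "rot_e3_quarter \<star> E = E" and h: "rot_e1_half \<star> E = E"
  defines "s \<equiv> (E $ 1 $ 1 $ 1 $ 1 - E $ 1 $ 1 $ 2 $ 2 - 2 * E $ 1 $ 2 $ 1 $ 2) / 4"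
  shows "E = tetragonal (E $ 1 $ 1 $ 1 $ 1 - s) (E $ 1 $ 1 $ 2 $ 2 + s) (E $ 3 $ 3 $ 3 $ 3)
    (E $ 1 $ 1 $ 3 $ 3) (E $ 1 $ 3 $ 1 $ 3) s"
proof -
  have h_nth: "E $ i $ j $ k $ l = (let \<epsilon> = (\<lambda>i::3. if i = 1 then 1 else - 1)
    in \<epsilon> i * \<epsilon> j * \<epsilon> k * \<epsilon> l * E $ i $ j $ k $ l)" for i j k l
    by (subst (1) h[symmetric]) (rule rot_e1_half_act)
  have r_nth: "E $ i $ j $ k $ l = (let \<epsilon> = (\<lambda>i. if i = 1 then - 1 else 1);
      \<pi> = (\<lambda>i::3. if i = 1 then 2 else if i = 2 then 1 else 3)
      in \<epsilon> i * \<epsilon> j * \<epsilon> k * \<epsilon> l * E $ \<pi> i $ \<pi> j $ \<pi> k $ \<pi> l)" for i j k l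
    by (subst (1) r[symmetric]) (rule rot_e3_quarter_act)
  \<comment> \<open>the square of the quarter turn is the half turn about \<open>e\<^sub>3\<close>\<close>
  have "\<forall>i p. (rot_e3_quarter ** rot_e3_quarter) $ i $ p = (if p = i then if i = 3 then 1 else - 1 else 0)"
    unfolding forall_3 by (simp add: rot_e3_quarter_def matrix_matrix_mult_def sum_3)
  moreover have "(rot_e3_quarter ** rot_e3_quarter) \<star> E = E"
    by (simp add: r flip: act_act)
  ultimately have r2_nth: "E $ i $ j $ k $ l = (let \<epsilon> = (\<lambda>i::3. if i = 3 then 1 else - 1)
    in \<epsilon> i * \<epsilon> j * \<epsilon> k * \<epsilon> l * E $ i $ j $ k $ l)" for i j k l
    using act_monomial[of "rot_e3_quarter ** rot_e3_quarter" "\<lambda>i. i" "\<lambda>i. if i = 3 then 1 else - 1" E]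
    by (simp add: Let_def)
  have zero1: "E $ i $ j $ k $ l = 0"
    if "(let n = (\<lambda>i::3. if i = 1 then 1 else 0::nat) in odd (n i + n j + n k + n l))" for i j k l
    using h_nth[of i j k l] that by (auto simp: Let_def split: if_splits)
  have zero3: "E $ i $ j $ k $ l = 0"
    if "(let n = (\<lambda>i::3. if i = 3 then 1 else 0::nat) in odd (n i + n j + n k + n l))" for i j k l
    using r2_nth[of i j k l] that by (auto simp: Let_def split: if_splits)
  have r_eqs: "E $ 2 $ 2 $ 2 $ 2 = E $ 1 $ 1 $ 1 $ 1" "E $ 2 $ 2 $ 3 $ 3 = E $ 1 $ 1 $ 3 $ 3"
    "E $ 2 $ 3 $ 2 $ 3 = E $ 1 $ 3 $ 1 $ 3"
    using r_nth[of 1 1 1 1] r_nth[of 1 1 3 3] r_nth[of 1 3 1 3] by (simp_all add: Let_def)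
  have sym_eqs: "E $ 2 $ 2 $ 1 $ 1 = E $ 1 $ 1 $ 2 $ 2" "E $ 3 $ 3 $ 1 $ 1 = E $ 1 $ 1 $ 3 $ 3"
    "E $ 3 $ 3 $ 2 $ 2 = E $ 1 $ 1 $ 3 $ 3"
    "E $ 1 $ 2 $ 2 $ 1 = E $ 1 $ 2 $ 1 $ 2" "E $ 2 $ 1 $ 1 $ 2 = E $ 1 $ 2 $ 1 $ 2"
    "E $ 1 $ 3 $ 3 $ 1 = E $ 1 $ 3 $ 1 $ 3" "E $ 3 $ 1 $ 1 $ 3 = E $ 1 $ 3 $ 1 $ 3"
    "E $ 2 $ 3 $ 3 $ 2 = E $ 1 $ 3 $ 1 $ 3" "E $ 3 $ 2 $ 2 $ 3 = E $ 1 $ 3 $ 1 $ 3"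
    "E $ 2 $ 1 $ 2 $ 1 = E $ 1 $ 2 $ 1 $ 2" "E $ 3 $ 1 $ 3 $ 1 = E $ 1 $ 3 $ 1 $ 3"
    "E $ 3 $ 2 $ 3 $ 2 = E $ 1 $ 3 $ 1 $ 3"
    using r_eqs by (metis Ela_nth[OF Ela])+
  show ?thesis
    unfolding vec_eq_iff forall_3
    by (simp add: zero1 zero3 r_eqs sym_eqs Let_def tetragonal_def s_def) (simp add: field_simps)
qed

section \<open>The dihedral group and the exact symmetry group\<close>

lemma D4_subset_iff:
  assumes "subgroup S SO3"
  shows "D4 \<subseteq> S \<longleftrightarrow> rot_e3_quarter \<in> S \<and> rot_e1_half \<in> S"
proof
  show "rot_e3_quarter \<in> S \<and> rot_e1_half \<in> S" if "D4 \<subseteq> S"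
    using that by (auto simp: D4_def intro: generate.incl)
  show "D4 \<subseteq> S" if "rot_e3_quarter \<in> S \<and> rot_e1_half \<in> S"
    using that assms group.generate_subgroup_incl[OF group_SO3] by (simp add: D4_def)
qed

text \<open>
  \<open>uniaxial 0 1\<close> is \<open>e\<^sub>3 \<otimes> e\<^sub>3\<close>, so its stabiliser consists of the matrices mapping \<open>e\<^sub>3\<close> to \<open>\<plusminus>e\<^sub>3\<close>.
\<close>

lemma act2_axis:
  assumes "act2 g (uniaxial 0 1) = uniaxial 0 1"
  shows "g $ 1 $ 3 = 0" "g $ 2 $ 3 = 0"
proof -
  have "act2 g (uniaxial 0 1) $ i $ i = uniaxial 0 1 $ i $ i" for i using assms by simp
  from this[of 1] this[of 2] show "g $ 1 $ 3 = 0" "g $ 2 $ 3 = 0"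
    by (simp_all add: act2_nth sum_3 uniaxial_def)
qed

lemma D4_preserves_axis:
  assumes "g \<in> D4"
  shows "g $ 1 $ 3 = 0" "g $ 2 $ 3 = 0"
proof -
  let ?S = "{g. rotation_matrix g \<and> act2 g (uniaxial 0 1) = uniaxial 0 1}"
  have "subgroup ?S SO3"
  proof (rule subgroup_SO3I)
    fix g assume g: "g \<in> ?S"
    then have "act2 (transpose g) (act2 g (uniaxial 0 1)) = uniaxial 0 1"
      by (metis (mono_tags, lifting) act2_act2 act2_id mem_Collect_eq rotation_transpose_mult(1))
    with g show "transpose g \<in> ?S" by (simp add: rotation_matrix_transpose)
  qed (auto simp: rotation_matrix_id rotation_matrix_mult simp flip: act2_act2)
  moreover have "rot_e3_quarter \<in> ?S" "rot_e1_half \<in> ?S"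
    by (simp_all add: rotations, simp_all add: vec_eq_iff forall_3 act2_nth sum_3 uniaxial_def
        rot_e3_quarter_def rot_e1_half_def)
  ultimately have "g \<in> ?S" using assms D4_subset_iff by blast
  then show "g $ 1 $ 3 = 0" "g $ 2 $ 3 = 0" using act2_axis by blast+
qed

text \<open>
  The first row of \<open>g\<close> is a unit vector orthogonal to \<open>e\<^sub>3\<close>, and the last hypothesis says that it is
  \<open>\<plusminus>e\<^sub>1\<close> or \<open>\<plusminus>e\<^sub>2\<close>. The eight resulting matrices are \<open>r\<^sup>k\<close> and \<open>r\<^sup>k h\<close> for the
  generators \<open>r\<close> and \<open>h\<close>.
\<close>

lemma D4I:
  assumes g: "rotation_matrix g" and axis: "g $ 1 $ 3 = 0" "g $ 2 $ 3 = 0"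
    and prod: "g $ 1 $ 1 * g $ 1 $ 2 = 0"
  shows "g \<in> D4"
proof -
  have "(transpose g ** g) $ i $ j = mat 1 $ i $ j" "(g ** transpose g) $ i $ j = mat 1 $ i $ j" for i j
    using g by (simp_all add: rotation_transpose_mult)
  note o = this[unfolded matrix_matrix_mult_def transpose_def mat_def, simplified, unfolded sum_3]
  have g33: "(g $ 3 $ 3)\<^sup>2 = 1" and g31: "g $ 3 $ 1 = 0" and g32: "g $ 3 $ 2 = 0"
    using o(1)[of 3 3] o(1)[of 1 3] o(1)[of 2 3] axis by (auto simp: power2_eq_square)
  have row1: "(g $ 1 $ 1)\<^sup>2 + (g $ 1 $ 2)\<^sup>2 = 1" and row2: "(g $ 2 $ 1)\<^sup>2 + (g $ 2 $ 2)\<^sup>2 = 1"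
    and row12: "g $ 1 $ 1 * g $ 2 $ 1 + g $ 1 $ 2 * g $ 2 $ 2 = 0"
    using o(2)[of 1 1] o(2)[of 2 2] o(2)[of 1 2] axis by (auto simp: power2_eq_square)
  have det: "(g $ 1 $ 1 * g $ 2 $ 2 - g $ 1 $ 2 * g $ 2 $ 1) * g $ 3 $ 3 = 1"
    using g axis g31 g32 by (simp add: rotation_matrix_def det_3 algebra_simps)
  let ?M = "\<lambda>a b c d e. vector [vector [a, b, 0], vector [c, d, 0], vector [0, 0, e]] :: tensor2"
  have g_eq: "g = ?M (g $ 1 $ 1) (g $ 1 $ 2) (g $ 2 $ 1) (g $ 2 $ 2) (g $ 3 $ 3)"
    using axis g31 g32 by (simp add: vec_eq_iff forall_3)
  have mult: "x ** y \<in> D4" if "x \<in> D4" "y \<in> D4" for x y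
    using generate.eng[of x SO3 _ y] that by (simp add: D4_def)
  have r: "?M 0 (-1) 1 0 1 \<in> D4" and h: "?M 1 0 0 (-1) (-1) \<in> D4"
    using generate.incl[of _ "{rot_e3_quarter, rot_e1_half}" SO3]
    by (simp_all add: D4_def rot_e3_quarter_def rot_e1_half_def)
  have M_mult: "?M a b c d e ** ?M a' b' c' d' e' =
      ?M (a * a' + b * c') (a * b' + b * d') (c * a' + d * c') (c * b' + d * d') (e * e')"
    for a b c d e a' b' c' d' e'
    by (simp add: vec_eq_iff forall_3 sum_3 matrix_matrix_mult_def)
  note r2 = mult[OF r r, unfolded M_mult, simplified]
  note r3 = mult[OF r2 r, unfolded M_mult, simplified]
  note r4 = mult[OF r2 r2, unfolded M_mult, simplified]
  note rh = mult[OF r h, unfolded M_mult, simplified]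
  note r2h = mult[OF r2 h, unfolded M_mult, simplified]
  note r3h = mult[OF r3 h, unfolded M_mult, simplified]
  have e: "g $ 3 $ 3 = 1 \<or> g $ 3 $ 3 = - 1" using g33 by (simp add: power2_eq_1_iff)
  show ?thesis
  proof (cases "g $ 1 $ 2 = 0")
    case True
    with row1 have a: "g $ 1 $ 1 = 1 \<or> g $ 1 $ 1 = - 1" by (simp add: power2_eq_1_iff)
    with True row12 have c: "g $ 2 $ 1 = 0" by auto
    show ?thesis
      by (subst g_eq) (use a c True e det r r2 r3 r4 h rh r2h r3h in auto)
  next
    case False
    with prod have a: "g $ 1 $ 1 = 0" by simp
    with row1 have b: "g $ 1 $ 2 = 1 \<or> g $ 1 $ 2 = - 1" by (simp add: power2_eq_1_iff)
    with a row12 have d: "g $ 2 $ 2 = 0" by auto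
    then have "g $ 2 $ 1 = 1 \<or> g $ 2 $ 1 = - 1" using row2 by (simp add: power2_eq_1_iff)
    then show ?thesis
      by (subst g_eq) (use a b d e det r r2 r3 r4 h rh r2h r3h in auto)
  qed
qed

lemma D4_subset_symmetry_group_iff:
  "D4 \<subseteq> symmetry_group E \<longleftrightarrow> rot_e3_quarter \<star> E = E \<and> rot_e1_half \<star> E = E"
  by (simp add: D4_subset_iff subgroup_symmetry_group)
    (simp add: symmetry_group_def rotations)

lemma symmetry_group_tetragonal:
  assumes d: "P + R + F \<noteq> 2 * F + C" and s: "s \<noteq> 0"
  shows "symmetry_group (tetragonal P R C F L s) = D4" (is "symmetry_group ?N = D4")
proof
  show "D4 \<subseteq> symmetry_group ?N"
    by (simp add: D4_subset_symmetry_group_iff act_tetragonal)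
  show "symmetry_group ?N \<subseteq> D4"
  proof
    fix g assume "g \<in> symmetry_group ?N"
    then have g: "rotation_matrix g" and N: "g \<star> ?N = ?N" by (auto simp: symmetry_group_def)
    have o: "orthogonal_matrix g" using g by (rule rotation_matrix_imp_orthogonal)
    let ?a = "P + R + F" and ?c = "2 * F + C"
    have uni: "uniaxial ?a ?c = ?a *\<^sub>R mat 1 + (?c - ?a) *\<^sub>R uniaxial 0 1"
      by (simp add: vec_eq_iff uniaxial_def mat_def)
    have "act2 g (uniaxial ?a ?c) = uniaxial ?a ?c"
      using dil_act[OF o, of ?N] by (simp add: N dil_tetragonal)
    then have "(?c - ?a) *\<^sub>R act2 g (uniaxial 0 1) = (?c - ?a) *\<^sub>R uniaxial 0 1"
      unfolding uni act2_linear act2_mat1[OF o] by simp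
    then have "act2 g (uniaxial 0 1) = uniaxial 0 1"
      using d by (simp only: scaleR_cancel_left) auto
    then have axis: "g $ 1 $ 3 = 0" "g $ 2 $ 3 = 0" using act2_axis by blast+
    have "(g ** transpose g) $ 1 $ 1 = 1" using g by (simp add: rotation_transpose_mult mat_def)
    then have row: "(g $ 1 $ 1)\<^sup>2 + (g $ 1 $ 2)\<^sup>2 = 1"
      using axis by (simp add: matrix_matrix_mult_def transpose_def sum_3 power2_eq_square)
    \<comment> \<open>the component \<open>1111\<close> of the rotated tensor; the right-hand side below is \<open>P + s\<close>,
      multiplied by a power of \<open>cos\<^sup>2 + sin\<^sup>2 = 1\<close> to make both sides homogeneous\<close>
    have "(P + s) * (((g $ 1 $ 1)\<^sup>2)\<^sup>2 + ((g $ 1 $ 2)\<^sup>2)\<^sup>2) + 2 * (P - 3 * s) * ((g $ 1 $ 1)\<^sup>2 * (g $ 1 $ 2)\<^sup>2)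
        = (g \<star> ?N) $ 1 $ 1 $ 1 $ 1"
      by (simp add: act_def sum_3 axis tetragonal_def) (simp add: power2_eq_square power4_eq_xxxx field_simps)
    also have "\<dots> = (P + s) * ((g $ 1 $ 1)\<^sup>2 + (g $ 1 $ 2)\<^sup>2)\<^sup>2"
      by (simp add: N row) (simp add: tetragonal_def)
    finally have "8 * s * (g $ 1 $ 1 * g $ 1 $ 2)\<^sup>2 = 0"
      by (simp add: power2_eq_square algebra_simps)
    then have "g $ 1 $ 1 * g $ 1 $ 2 = 0" using s by simp
    then show "g \<in> D4" using g axis D4I by blast
  qed
qed

text \<open>
  Otherwise \<open>s = \<plusminus>5 x\<close> and the tensor is fixed by a quarter turn about \<open>e\<^sub>1\<close> (for the sign \<open>+\<close>) or
  about an axis at angle \<open>\<pi>/4\<close> to it (for the sign \<open>-\<close>), neither of which preserves the axis \<open>e\<^sub>3\<close>.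
\<close>

lemma symmetry_group_D4_imp_not_cubic:
  assumes sym: "symmetry_group (tetragonal P R C F L s) = D4"
  shows "P + R + F \<noteq> 2 * F + C \<or> (3 * P - R) / 2 + L \<noteq> 2 * L + C \<or>
    s\<^sup>2 \<noteq> 25 * ((P + C - 2 * F - 4 * L) / 35)\<^sup>2"
proof (rule ccontr)
  assume "\<not> ?thesis"
  then have d: "P + R + F = 2 * F + C" and v: "(3 * P - R) / 2 + L = 2 * L + C"
    and "s\<^sup>2 = ((P + C - 2 * F - 4 * L) / 7)\<^sup>2"
    by (auto simp: power_divide)
  then consider "s = (P + C - 2 * F - 4 * L) / 7" | "- s = (P + C - 2 * F - 4 * L) / 7"
    by (auto simp: power2_eq_iff)
  then show False
  proof cases
    case 1
    have "C = P + s" "F = R - s" "L = (P - R) / 2 - s"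
      using 1 d v by (simp_all add: field_simps)
    then have "rot_e1_quarter \<in> symmetry_group (tetragonal P R C F L s)"
      unfolding symmetry_group_def using rotations act_cubic by simp
    then show False
      using D4_preserves_axis(2) unfolding sym by (force simp: rot_e1_quarter_def)
  next
    case 2
    let ?g = "transpose rot_e3_eighth ** (rot_e1_quarter ** rot_e3_eighth)"
    have "C = P + - s" "F = R - - s" "L = (P - R) / 2 - - s"
      using 2 d v by (simp_all add: field_simps)
    then have "rot_e1_quarter \<star> tetragonal P R C F L (- s) = tetragonal P R C F L (- s)"
      by (rule act_cubic)
    moreover have "transpose rot_e3_eighth \<star> tetragonal P R C F L (- s) = tetragonal P R C F L s"
      using rotations(4) by (simp add: act_act rotation_transpose_mult flip: rot_e3_eighth_act)
    ultimately have "?g \<star> tetragonal P R C F L s = tetragonal P R C F L s"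
      by (simp add: rot_e3_eighth_act flip: act_act)
    then have "?g \<in> symmetry_group (tetragonal P R C F L s)"
      unfolding symmetry_group_def
      by (simp add: rotations rotation_matrix_mult rotation_matrix_transpose)
    then have "?g $ 1 $ 3 = 0"
      unfolding sym by (rule D4_preserves_axis)
    then show False
      by (simp add: matrix_matrix_mult_def transpose_def sum_3 rot_e3_eighth_def rot_e1_quarter_def
          Let_def)
  qed
qed

section \<open>Separation of orbits, independence, and the basis property\<close>

lemma mem_stratum_D4D:
  assumes "E \<in> stratum D4"
  obtains g P R C F L s where "rotation_matrix g" "E = g \<star> tetragonal P R C F L s"
    "symmetry_group (tetragonal P R C F L s) = D4"
proof -
  obtain g N where g: "rotation_matrix g" "E = g \<star> N" and N: "N \<in> Ela" "symmetry_group N = D4"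
    using assms unfolding mem_stratum_iff by blast
  then have "rot_e3_quarter \<star> N = N" "rot_e1_half \<star> N = N"
    using D4_subset_symmetry_group_iff[of N] by simp_all
  from tetragonalI[OF N(1) this] obtain P R C F L s where "N = tetragonal P R C F L s" by blast
  with g N that show ?thesis by blast
qed

lemma stratum_D4_separated:
  assumes "E \<in> stratum D4" "E' \<in> stratum D4"
    and eq: "kappa1 E = kappa1 E'" "kappa2 E = kappa2 E'" "kappa3 E = kappa3 E'"
      "kappa4 E = kappa4 E'" "kappa5 E = kappa5 E'" "kappa6 E = kappa6 E'"
  shows "\<exists>g. rotation_matrix g \<and> E' = g \<star> E"
proof -
  obtain g P R C F L s where g: "rotation_matrix g" and E: "E = g \<star> tetragonal P R C F L s"
    and sym: "symmetry_group (tetragonal P R C F L s) = D4"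
    using assms mem_stratum_D4D by blast
  obtain g' P' R' C' F' L' s' where g': "rotation_matrix g'" and E': "E' = g' \<star> tetragonal P' R' C' F' L' s'"
    and sym': "symmetry_group (tetragonal P' R' C' F' L' s') = D4"
    using assms mem_stratum_D4D by blast
  note og = rotation_matrix_imp_orthogonal[OF g] and og' = rotation_matrix_imp_orthogonal[OF g']
  note k = kappa_tetragonal(1-3) kappa_tetragonal(4)[OF symmetry_group_D4_imp_not_cubic[OF sym]]
    kappa_tetragonal(4)[OF symmetry_group_D4_imp_not_cubic[OF sym']]
  have x: "P + C - 2 * F - 4 * L = P' + C' - 2 * F' - 4 * L'"
    using eq(5) unfolding E E' kappa_act[OF og] kappa_act[OF og'] by (simp add: k)
  have d: "P + R + F = P' + R' + F'" "2 * F + C = 2 * F' + C'"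
    using eq(1,3) unfolding E E' kappa_act[OF og] kappa_act[OF og'] by (simp_all add: k)
  have v: "3 * P - R + 2 * L = 3 * P' - R' + 2 * L'" "2 * L + C = 2 * L' + C'"
    using eq(2,4) unfolding E E' kappa_act[OF og] kappa_act[OF og']
    by (simp_all add: k field_simps)
  have s: "s\<^sup>2 = s'\<^sup>2"
    using eq(6) unfolding E E' kappa_act[OF og] kappa_act[OF og'] by (simp add: k x)
  have params: "P' = P" "R' = R" "C' = C" "F' = F" "L' = L"
    using x d v by linarith+
  have N: "tetragonal P R C F L s = transpose g \<star> E"
    using g by (simp add: E act_act rotation_transpose_mult)
  from s consider "s' = s" | "s' = - s" by (auto simp: power2_eq_iff)
  then show ?thesis
  proof cases
    case 1
    then have "E' = (g' ** transpose g) \<star> E" by (simp add: E' params N flip: act_act)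
    moreover have "rotation_matrix (g' ** transpose g)"
      by (intro rotation_matrix_mult rotation_matrix_transpose g g')
    ultimately show ?thesis by blast
  next
    case 2
    then have "E' = (g' ** (rot_e3_eighth ** transpose g)) \<star> E"
      by (simp add: E' params flip: rot_e3_eighth_act act_act N)
    moreover have "rotation_matrix (g' ** (rot_e3_eighth ** transpose g))"
      by (intro rotation_matrix_mult rotation_matrix_transpose rotations g g')
    ultimately show ?thesis by blast
  qed
qed

lemma stratum_D4_realises:
  assumes "k3 \<noteq> 0" "s \<noteq> 0"
  obtains E where "E \<in> stratum D4" "kappa1 E = k1" "kappa2 E = k2" "kappa3 E = k3"
    "kappa4 E = k4" "kappa5 E = k5" "kappa6 E = 35 / 8 * k5\<^sup>2 + 8 * s\<^sup>2"
proof -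
  \<comment> \<open>\<open>d1\<close>, \<open>d3\<close> and \<open>v1\<close>, \<open>v3\<close> are the required eigenvalues of \<open>d\<close> and \<open>v\<close>; the other
    definitions invert the linear map from \<open>(P, R, C, F, L)\<close> to \<open>(d1, d3, v1, v3, x)\<close> with
    \<open>x = k5 / 8\<close>\<close>
  define d1 where "d1 = k1 / 3 - k3 / 2"
  define d3 where "d3 = k1 / 3 + k3"
  define v1 where "v1 = k2 / 3 - k4 / 2"
  define v3 where "v3 = k2 / 3 + k4"
  define L where "L = (2 * v1 + d1 - 35 / 2 * k5 - 9 / 2 * d3 + 17 / 2 * v3) / 35"
  define C where "C = v3 - 2 * L"
  define F where "F = (d3 - C) / 2"
  define P where "P = 35 / 8 * k5 - C + 2 * F + 4 * L"
  define R where "R = d1 - F - P"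
  let ?N = "tetragonal P R C F L s"
  have d: "P + R + F = d1" "2 * F + C = d3" and v3: "2 * L + C = v3"
    and x: "(P + C - 2 * F - 4 * L) / 35 = k5 / 8"
    by (simp_all add: R_def P_def) (simp_all add: F_def C_def field_simps)
  have v1: "(3 * P - R) / 2 + L = v1"
    unfolding R_def P_def F_def C_def L_def by (simp add: field_simps)
  have ne: "P + R + F \<noteq> 2 * F + C" using assms by (simp add: d d1_def d3_def)
  then have "symmetry_group ?N = D4" using assms symmetry_group_tetragonal by blast
  then have "?N \<in> stratum D4"
    unfolding mem_stratum_iff using rotation_matrix_id act_id tetragonal_mem_Ela by metis
  moreover have "kappa1 ?N = k1" "kappa2 ?N = k2" "kappa6 ?N = 35 / 8 * k5\<^sup>2 + 8 * s\<^sup>2"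
    unfolding kappa_tetragonal d v1 v3 x
    by (simp_all add: d1_def d3_def v1_def v3_def power2_eq_square field_simps)
  moreover have "kappa3 ?N = k3" "kappa4 ?N = k4" "kappa5 ?N = k5"
    using kappa_tetragonal(4)[of P R F C L s] ne unfolding d v1 v3 x
    by (simp_all add: d1_def d3_def v1_def v3_def field_simps)
  ultimately show ?thesis using that by blast
qed

text \<open>
  A finite family of invariants that separates orbits, and in which each member can be varied with
  all the others fixed, is a minimal functional basis, with pairwise distinct restrictions. The
  function \<open>F\<close> of the values is obtained by choosing a point with the given values.
\<close>

lemma minimal_functional_basis_restrictI:
  fixes \<kappa> :: "'i \<Rightarrow> tensor4 \<Rightarrow> real"
  assumes stable: "stable X" and fin: "finite I"
    and inv: "\<And>i g x. i \<in> I \<Longrightarrow> g \<in> carrier SO3 \<Longrightarrow> x \<in> X \<Longrightarrow> \<kappa> i (g \<star> x) = \<kappa> i x"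
    and sep: "\<And>x y. x \<in> X \<Longrightarrow> y \<in> X \<Longrightarrow> (\<And>i. i \<in> I \<Longrightarrow> \<kappa> i x = \<kappa> i y) \<Longrightarrow>
      \<exists>g \<in> carrier SO3. y = g \<star> x"
    and indep: "\<And>i. i \<in> I \<Longrightarrow>
      \<exists>x \<in> X. \<exists>y \<in> X. \<kappa> i x \<noteq> \<kappa> i y \<and> (\<forall>j \<in> I - {i}. \<kappa> j x = \<kappa> j y)"
  defines "\<Phi> \<equiv> (\<lambda>i. restrict (\<kappa> i) X) ` I"
  shows "card \<Phi> = card I \<and> minimal_functional_basis X \<Phi>"
proof
  have "inj_on (\<lambda>i. restrict (\<kappa> i) X) I"
  proof (rule inj_onI, rule ccontr)
    fix i j assume ij: "i \<in> I" "j \<in> I" "i \<noteq> j" and eq: "restrict (\<kappa> i) X = restrict (\<kappa> j) X"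
    have "\<kappa> i x = \<kappa> j x" if "x \<in> X" for x
      using fun_cong[OF eq, of x] that by simp
    moreover obtain x y where "x \<in> X" "y \<in> X" "\<kappa> i x \<noteq> \<kappa> i y" "\<kappa> j x = \<kappa> j y"
      using indep[of i] ij by blast
    ultimately show False by simp
  qed
  then show "card \<Phi> = card I" unfolding \<Phi>_def by (rule card_image)
  have \<Phi>: "\<Phi> \<subseteq> invariants X"
    using stable inv by (auto simp: \<Phi>_def invariants_def stable_def)
  have "\<exists>F. \<forall>x \<in> X. f x = F (\<lambda>\<phi>\<in>\<Phi>. \<phi> x)" if f: "f \<in> invariants X" for f
  proof -
    let ?p = "\<lambda>x. \<lambda>\<phi>\<in>\<Phi>. \<phi> x"
    have f_eq: "f x = f y" if xy: "x \<in> X" "y \<in> X" and p: "?p x = ?p y" for x y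
    proof -
      have "\<kappa> i x = \<kappa> i y" if "i \<in> I" for i
        using fun_cong[OF p, of "restrict (\<kappa> i) X"] that xy by (simp add: \<Phi>_def)
      then obtain g where "g \<in> carrier SO3" "y = g \<star> x" using sep xy by blast
      then show ?thesis using f xy by (simp add: invariants_def)
    qed
    have "f x = f (SOME y. y \<in> X \<and> ?p y = ?p x)" if "x \<in> X" for x
    proof -
      have "(SOME y. y \<in> X \<and> ?p y = ?p x) \<in> X \<and> ?p (SOME y. y \<in> X \<and> ?p y = ?p x) = ?p x"
        by (rule someI[of _ x]) (simp add: that)
      then show ?thesis using that by (intro f_eq) simp_all
    qed
    then show ?thesis by (intro exI[of _ "\<lambda>t. f (SOME y. y \<in> X \<and> ?p y = t)"] ballI)
  qed
  then have basis: "functional_basis X \<Phi>"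
    unfolding functional_basis_def using stable fin \<Phi> by (simp add: \<Phi>_def)
  have "\<not> functional_basis X \<Psi>" if \<Psi>: "\<Psi> \<subset> \<Phi>" for \<Psi>
  proof
    assume "functional_basis X \<Psi>"
    obtain i where i: "i \<in> I" "restrict (\<kappa> i) X \<notin> \<Psi>" using \<Psi> by (auto simp: \<Phi>_def)
    have "restrict (\<kappa> i) X \<in> invariants X" using \<Phi> i(1) by (auto simp: \<Phi>_def)
    then obtain F where F: "\<And>x. x \<in> X \<Longrightarrow> restrict (\<kappa> i) X x = F (\<lambda>\<phi>\<in>\<Psi>. \<phi> x)"
      using \<open>functional_basis X \<Psi>\<close> unfolding functional_basis_def by blast
    obtain x y where xy: "x \<in> X" "y \<in> X" "\<kappa> i x \<noteq> \<kappa> i y"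
      and eq: "\<And>j. j \<in> I - {i} \<Longrightarrow> \<kappa> j x = \<kappa> j y"
      using indep[OF i(1)] by blast
    have "\<phi> x = \<phi> y" if "\<phi> \<in> \<Psi>" for \<phi>
    proof -
      have "\<phi> \<in> \<Phi>" using that \<Psi> by blast
      then obtain j where "j \<in> I" "\<phi> = restrict (\<kappa> j) X" unfolding \<Phi>_def by blast
      moreover from this i that have "j \<noteq> i" by blast
      ultimately show ?thesis using eq[of j] xy by simp
    qed
    then have "(\<lambda>\<phi>\<in>\<Psi>. \<phi> x) = (\<lambda>\<phi>\<in>\<Psi>. \<phi> y)" by (intro restrict_ext) blast
    then show False using F[of x] F[of y] xy by simp
  qed
  with basis show "minimal_functional_basis X \<Phi>"
    unfolding minimal_functional_basis_def by blast
qed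

theorem theorem6p3:
  fixes \<Sigma> :: "tensor4 set" and K :: "(tensor4 \<Rightarrow> real) set"
  defines "\<Sigma> \<equiv> stratum D4"
    and "K \<equiv> (\<lambda>\<kappa>. restrict \<kappa> \<Sigma>) ` {kappa1, kappa2, kappa3, kappa4, kappa5, kappa6}"
  shows "card K = 6 \<and> minimal_functional_basis \<Sigma> K"
proof -
  define \<kappa> where "\<kappa> i = [kappa1, kappa2, kappa3, kappa4, kappa5, kappa6] ! i" for i
  have I: "{..<6} = {0, 1, 2, 3, 4, 5::nat}" by auto
  have \<kappa>: "\<kappa> 0 = kappa1" "\<kappa> 1 = kappa2" "\<kappa> 2 = kappa3" "\<kappa> 3 = kappa4" "\<kappa> 4 = kappa5" "\<kappa> 5 = kappa6"
    by (simp_all add: \<kappa>_def)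
  have "card ((\<lambda>i. restrict (\<kappa> i) \<Sigma>) ` {..<6}) = card {..<6::nat} \<and>
      minimal_functional_basis \<Sigma> ((\<lambda>i. restrict (\<kappa> i) \<Sigma>) ` {..<6})"
  proof (rule minimal_functional_basis_restrictI)
    show "stable \<Sigma>" unfolding \<Sigma>_def by (rule stable_stratum)
    show "finite {..<6::nat}" by simp
    show "\<kappa> i (g \<star> x) = \<kappa> i x" if "i \<in> {..<6}" "g \<in> carrier SO3" "x \<in> \<Sigma>" for i g x
      using that kappa_act[of g x] unfolding I
      by (auto simp: \<kappa> \<kappa>[unfolded One_nat_def] rotation_matrix_imp_orthogonal)
    show "\<exists>g \<in> carrier SO3. y = g \<star> x"
      if "x \<in> \<Sigma>" "y \<in> \<Sigma>" and eq: "\<And>i. i \<in> {..<6} \<Longrightarrow> \<kappa> i x = \<kappa> i y" for x y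
      using stratum_D4_separated[of x y] that(1,2) eq[of 0] eq[of 1] eq[of 2] eq[of 3] eq[of 4] eq[of 5]
      by (auto simp: \<kappa> \<kappa>[unfolded One_nat_def] \<Sigma>_def)
    show "\<exists>x \<in> \<Sigma>. \<exists>y \<in> \<Sigma>. \<kappa> i x \<noteq> \<kappa> i y \<and> (\<forall>j \<in> {..<6} - {i}. \<kappa> j x = \<kappa> j y)"
      if i_less: "i \<in> {..<6}" for i
    proof -
      note [simp] = \<kappa> \<kappa>[unfolded One_nat_def]
      \<comment> \<open>a base point \<open>x\<close> with \<open>k3 \<noteq> 0\<close> and \<open>s = 1\<close>; in each case \<open>y\<close> differs from it in one value.
        For \<open>\<kappa>\<^sub>5\<close> only the sign is changed, because \<open>\<kappa>\<^sub>6\<close> depends on \<open>\<kappa>\<^sub>5\<^sup>2\<close>; for \<open>\<kappa>\<^sub>6\<close>, \<open>s\<close> is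
        changed to \<open>2\<close>.\<close>
      obtain x where x: "x \<in> \<Sigma>" "kappa1 x = 0" "kappa2 x = 0" "kappa3 x = 1" "kappa4 x = 0"
        "kappa5 x = 1" "kappa6 x = 35 / 8 + 8"
        by (rule stratum_D4_realises[of 1 1 0 0 0 1]) (simp_all add: \<Sigma>_def)
      consider "i = 0" | "i = 1" | "i = 2" | "i = 3" | "i = 4" | "i = 5"
        using i_less unfolding I by auto
      then show ?thesis
      proof cases
        case i: 1
        obtain y where "y \<in> \<Sigma>" "kappa1 y = 1" "kappa2 y = 0" "kappa3 y = 1"
          "kappa4 y = 0" "kappa5 y = 1" "kappa6 y = 35 / 8 + 8"
          by (rule stratum_D4_realises[of 1 1 1 0 0 1]) (simp_all add: \<Sigma>_def)
        with x i show ?thesis unfolding I by (intro bexI[of _ x] bexI[of _ y]) auto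
      next
        case i: 2
        obtain y where "y \<in> \<Sigma>" "kappa1 y = 0" "kappa2 y = 1" "kappa3 y = 1"
          "kappa4 y = 0" "kappa5 y = 1" "kappa6 y = 35 / 8 + 8"
          by (rule stratum_D4_realises[of 1 1 0 1 0 1]) (simp_all add: \<Sigma>_def)
        with x i show ?thesis unfolding I by (intro bexI[of _ x] bexI[of _ y]) auto
      next
        case i: 3
        obtain y where "y \<in> \<Sigma>" "kappa1 y = 0" "kappa2 y = 0" "kappa3 y = 2"
          "kappa4 y = 0" "kappa5 y = 1" "kappa6 y = 35 / 8 + 8"
          by (rule stratum_D4_realises[of 2 1 0 0 0 1]) (simp_all add: \<Sigma>_def)
        with x i show ?thesis unfolding I by (intro bexI[of _ x] bexI[of _ y]) auto
      next
        case i: 4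
        obtain y where "y \<in> \<Sigma>" "kappa1 y = 0" "kappa2 y = 0" "kappa3 y = 1"
          "kappa4 y = 1" "kappa5 y = 1" "kappa6 y = 35 / 8 + 8"
          by (rule stratum_D4_realises[of 1 1 0 0 1 1]) (simp_all add: \<Sigma>_def)
        with x i show ?thesis unfolding I by (intro bexI[of _ x] bexI[of _ y]) auto
      next
        case i: 5
        obtain y where "y \<in> \<Sigma>" "kappa1 y = 0" "kappa2 y = 0" "kappa3 y = 1"
          "kappa4 y = 0" "kappa5 y = - 1" "kappa6 y = 35 / 8 + 8"
          by (rule stratum_D4_realises[of 1 1 0 0 0 "- 1"]) (simp_all add: \<Sigma>_def)
        with x i show ?thesis unfolding I by (intro bexI[of _ x] bexI[of _ y]) auto
      next
        case i: 6
        obtain y where "y \<in> \<Sigma>" "kappa1 y = 0" "kappa2 y = 0" "kappa3 y = 1"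
          "kappa4 y = 0" "kappa5 y = 1" "kappa6 y = 35 / 8 + 32"
          by (rule stratum_D4_realises[of 1 2 0 0 0 1]) (simp_all add: \<Sigma>_def)
        with x i show ?thesis unfolding I by (intro bexI[of _ x] bexI[of _ y]) auto
      qed
    qed
  qed
  moreover have "(\<lambda>i. restrict (\<kappa> i) \<Sigma>) ` {..<6} = K"
    unfolding K_def I by (simp add: \<kappa> \<kappa>[unfolded One_nat_def])
  ultimately show ?thesis by simp
qed

end
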